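(* Let $\gamma>0$ and $\theta_n=\dfrac{\Gamma(n+\gamma+1)}{n!}$ for $n\ge1$ (equivalently $\sum_{n\ge1}\theta_nz^n=\Gamma(\gamma+1)(1-z)^{-\gamma-1}-\Gamma(\gamma+1)$; note $\theta_n=n^\gamma(1+o(1))$). Let $a=\Gamma(\gamma+1)^{\frac1{\gamma+1}}$. Then, under $\mathbb{P}_n$: (a) $L_1/n^{\frac1{1+\gamma}}$ converges weakly to the Gamma distribution with shape $\gamma+1$ and rate $a$, i.e. for all $s>0$, \[ \lim_{n\to\infty}\mathbb{P}_n\Bigl(\frac{L_1}{n^{1/(1+\gamma)}}<s\Bigr)=\int_0^s x^\gamma e^{-ax}\,dx; \] (b) $\displaystyle\lim_{n\to\infty}n^{-\frac{\gamma}{\gamma+1}}\mathbb{E}_n(K)=\bigl(\Gamma(\gamma)/\gamma^\gamma\bigr)^{\frac1{\gamma+1}}$; (c) $R_1,R_2,\dots$ converge weakly to independent Poisson random variables with means $\theta_1,\frac{\theta_2}2,\frac{\theta_3}{3},\dots$.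
   Context: For $\sigma\in\mathcal{S}_n$ (permutations of $\{1,\dots,n\}$), $R_j(\sigma)$ is the number of cycles of length $j$, $L_1(\sigma)$ the length of the cycle containing $1$, $K(\sigma)=\sum_jR_j(\sigma)$. Given parameters $\theta_j\ge0$, $h_n=\frac1{n!}\sum_{\sigma\in\mathcal{S}_n}\prod_j\theta_j^{R_j(\sigma)}$ and $\mathbb{P}_n(\sigma)=\frac1{n!h_n}\prod_j\theta_j^{R_j(\sigma)}$, with expectation $\mathbb{E}_n$. *)

theory Defs
  imports "HOL-Analysis.Analysis" "HOL-Combinatorics.Combinatorics"
begin

definition perms :: "nat \<Rightarrow> (nat \<Rightarrow> nat) set" where
  "perms n = {\<sigma>. \<sigma> permutes {1..n}}"

definition cyc_count :: "nat \<Rightarrow> (nat \<Rightarrow> nat) \<Rightarrow> nat \<Rightarrow> nat" where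
  "cyc_count n \<sigma> j = card {orbit \<sigma> i | i. i \<in> {1..n} \<and> card (orbit \<sigma> i) = j}"

definition num_cycles :: "nat \<Rightarrow> (nat \<Rightarrow> nat) \<Rightarrow> nat" where
  "num_cycles n \<sigma> = card {orbit \<sigma> i | i. i \<in> {1..n}}"

definition cyc_len1 :: "(nat \<Rightarrow> nat) \<Rightarrow> nat" where
  "cyc_len1 \<sigma> = card (orbit \<sigma> 1)"

definition weight :: "(nat \<Rightarrow> real) \<Rightarrow> nat \<Rightarrow> (nat \<Rightarrow> nat) \<Rightarrow> real" where
  "weight \<theta> n \<sigma> = (\<Prod>j\<in>{1..n}. \<theta> j ^ cyc_count n \<sigma> j)"

definition h_n :: "(nat \<Rightarrow> real) \<Rightarrow> nat \<Rightarrow> real" where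
  "h_n \<theta> n = (1 / fact n) * (\<Sum>\<sigma>\<in>perms n. weight \<theta> n \<sigma>)"

definition Pn :: "(nat \<Rightarrow> real) \<Rightarrow> nat \<Rightarrow> (nat \<Rightarrow> nat) set \<Rightarrow> real" where
  "Pn \<theta> n A = (\<Sum>\<sigma>\<in>perms n \<inter> A. weight \<theta> n \<sigma> / (fact n * h_n \<theta> n))"

definition En :: "(nat \<Rightarrow> real) \<Rightarrow> nat \<Rightarrow> ((nat \<Rightarrow> nat) \<Rightarrow> real) \<Rightarrow> real" where
  "En \<theta> n X = (\<Sum>\<sigma>\<in>perms n. X \<sigma> * weight \<theta> n \<sigma> / (fact n * h_n \<theta> n))"

end

theory Submission
  imports Defs "HOL-Computational_Algebra.Formal_Power_Series" "HOL-Real_Asymp.Real_Asymp"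
begin

text \<open>
  Removing the cycle through a point turns sums over permutations into the recursion
  \<open>n h n = (\<Sum>j=1..n. \<theta> j * h (n - j))\<close>, so that
  \<open>P (L1 = l) = \<theta> l * h (n - l) / (n * h n)\<close>. Everything then rests on the quotients
  \<open>h (n - l) / h n\<close> for \<open>l\<close> of order \<open>N n = n powr (1 / (\<gamma> + 1))\<close>, for which no saddle point analysis
  is needed. After changing finitely many \<open>\<theta> j\<close>, which multiplies \<open>h n\<close> asymptotically by a constant,
  the sequence is log-concave. Log-concavity gives \<open>h (n - j) \<le> r ^ j * h n\<close> with
  \<open>r = h (n - 1) / h n\<close>, so the recursion yields
  \<open>n \<le> (\<Sum>j. \<theta> j * r ^ j) \<approx> \<Gamma> (\<gamma> + 1) * (1 - r) powr (- \<gamma> - 1)\<close>, that is \<open>1 - r \<le> (1 + o 1) * a / N n\<close>.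
  Hence the rescaled law of \<open>L1\<close> has a density whose lower limit is at least
  \<open>u powr \<gamma> * exp (- a * u)\<close>; since this already has total mass 1, Scheffe's argument forces
  convergence in \<open>L\<^sup>1\<close>, which gives (a), and (b) up to a uniform estimate for short cycles. Part (c)
  again compares two parameter sequences that differ in finitely many places.
\<close>

section \<open>Cycles through a point\<close>

text \<open>The generating function of \<open>h\<close> is the exponential of a function with an
  algebraic singularity at 1, so \<open>h (n - l) / h n\<close> has a nontrivial limit already for l
  of order \<open>N n\<close>. Only one side of this limit is ever estimated directly: an upper
  bound for 1 - r, hence a lower bound for the quotient. Total mass supplies the other side, because
  the \<open>a\<close> obtained by solving
  \<open>n = \<Gamma> (\<gamma> + 1) * (1 - r) powr (- \<gamma> - 1)\<close> for 1 - r is the very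
  rate that normalises the limit density: both conditions read
  \<open>a powr (\<gamma> + 1) = \<Gamma> (\<gamma> + 1)\<close>. The constant factor caused by
  changing finitely many weights cancels in the quotients. The combinatorics is stated for
  \<open>cyc_lens S \<sigma>\<close> on arbitrary finite \<open>S\<close>, since the complement of a
  cycle is no initial segment. A cycle is removed by deleting its points one at a time, which avoids
  choosing its support and relabelling. The multiset of cycle lengths carries the weight and the
  cycle counts together, so one removal lemma serves \<open>h\<close>, the law of \<open>L1\<close>
  and (c).\<close>

definition cyc_lens :: "'a set \<Rightarrow> ('a \<Rightarrow> 'a) \<Rightarrow> nat multiset" where
  "cyc_lens S \<sigma> = image_mset card (mset_set (orbit \<sigma> ` S))"

text \<open>\<open>orbit\<close> is generated from \<open>\<sigma> x\<close>, not from
  \<open>x\<close>; that it returns to \<open>x\<close> uses that \<open>\<sigma>\<close> permutes a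
  finite set.\<close>

lemma permutes_self_in_orbit:
  assumes "finite S" "\<sigma> permutes S"
  shows "x \<in> orbit \<sigma> x"
  by (rule permutation_self_in_orbit) (use assms permutation_permutes in blast)

lemma permutes_orbit_eqI:
  assumes "finite S" "\<sigma> permutes S" "z \<in> orbit \<sigma> x"
  shows "orbit \<sigma> z = orbit \<sigma> x"
proof -
  have "x \<in> orbit \<sigma> z"
    using orbit_swap[OF permutes_self_in_orbit[OF assms(1,2)] assms(3)] .
  then show ?thesis
    using assms(3) orbit_trans[of _ \<sigma> x z] orbit_trans[of _ \<sigma> z x] by auto
qed

lemma orbit_image_remove:
  assumes "finite S" "\<sigma> permutes S" "x \<in> S"
  shows "orbit \<sigma> ` S = insert (orbit \<sigma> x) (orbit \<sigma> ` (S - orbit \<sigma> x))"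
    and "orbit \<sigma> x \<notin> orbit \<sigma> ` (S - orbit \<sigma> x)"
proof -
  show "orbit \<sigma> ` S = insert (orbit \<sigma> x) (orbit \<sigma> ` (S - orbit \<sigma> x))"
    using assms(3) permutes_orbit_eqI[OF assms(1,2)] by blast
  show "orbit \<sigma> x \<notin> orbit \<sigma> ` (S - orbit \<sigma> x)"
    using permutes_self_in_orbit[OF assms(1,2)] by blast
qed

lemma cyc_lens_remove:
  assumes "finite S" "\<sigma> permutes S" "x \<in> S"
  shows "cyc_lens S \<sigma> = add_mset (card (orbit \<sigma> x))
           (image_mset card (mset_set (orbit \<sigma> ` (S - orbit \<sigma> x))))"
  unfolding cyc_lens_def orbit_image_remove(1)[OF assms]
  using orbit_image_remove(2)[OF assms] assms(1) by simp

text \<open>Since \<open>\<tau>\<close> fixes \<open>y\<close>, the map \<open>\<sigma>\<close> is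
  \<open>\<tau>\<close> with \<open>y\<close> inserted directly after \<open>x\<close>. The cycle
  through \<open>x\<close> gains one point and all other cycles stay as they are.\<close>

context
  fixes S :: "'a set" and x y :: 'a and \<tau> \<sigma> :: "'a \<Rightarrow> 'a"
  assumes fin: "finite S" and xy: "x \<in> S" "y \<in> S" "x \<noteq> y"
    and \<tau>: "\<tau> permutes (S - {y})" and \<sigma>: "\<sigma> = \<tau> \<circ> Transposition.transpose x y"
begin

lemma insert_point_apply: "\<sigma> x = y" "\<sigma> y = \<tau> x" "z \<noteq> x \<Longrightarrow> z \<noteq> y \<Longrightarrow> \<sigma> z = \<tau> z"
  using permutes_not_in[OF \<tau>, of y] unfolding \<sigma> by auto

lemma insert_point_notin: "y \<notin> orbit \<tau> x"
  using permutes_orbit_subset[OF \<tau>, of x] xy by auto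

lemma insert_point_orbit: "orbit \<sigma> x = insert y (orbit \<tau> x)"
proof
  have x\<tau>: "x \<in> orbit \<tau> x"
    by (rule permutes_self_in_orbit[OF _ \<tau>]) (use fin in auto)
  show "orbit \<sigma> x \<subseteq> insert y (orbit \<tau> x)"
  proof
    fix z assume "z \<in> orbit \<sigma> x"
    then show "z \<in> insert y (orbit \<tau> x)"
    proof induction
      case base then show ?case by (simp add: insert_point_apply)
    next
      case (step z)
      then show ?case
        by (cases "z = x"; cases "z = y") (auto simp: insert_point_apply intro: orbit.intros)
    qed
  qed
  have yo: "y \<in> orbit \<sigma> x" using orbit.base[of \<sigma> x] by (simp add: insert_point_apply)
  have xo: "\<tau> x \<in> orbit \<sigma> x" using orbit.step[OF yo] by (simp add: insert_point_apply)
  have "z \<in> orbit \<sigma> x" if "z \<in> orbit \<tau> x" for z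
    using that
  proof induction
    case base then show ?case by (rule xo)
  next
    case (step z)
    then show ?case
      using orbit.step[of z \<sigma> x] xo insert_point_notin insert_point_apply
      by (cases "z = x"; cases "z = y") auto
  qed
  with yo show "insert y (orbit \<tau> x) \<subseteq> orbit \<sigma> x" by auto
qed

lemma insert_point_other_orbits:
  "orbit \<sigma> ` (S - orbit \<sigma> x) = orbit \<tau> ` (S - {y} - orbit \<tau> x)"
proof -
  have eq: "S - orbit \<sigma> x = S - {y} - orbit \<tau> x"
    unfolding insert_point_orbit by auto
  have fin': "finite (S - {y})" using fin by simp
  have "orbit \<tau> z = orbit \<sigma> z" if z: "z \<in> S - {y} - orbit \<tau> x" for z
  proof (rule orbit_cong0[where A = "orbit \<tau> z"])
    show "z \<in> orbit \<tau> z" by (rule permutes_self_in_orbit[OF fin' \<tau>])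
    show "\<tau> \<in> orbit \<tau> z \<rightarrow> orbit \<tau> z" by (auto intro: orbit.intros)
    fix w assume w: "w \<in> orbit \<tau> z"
    have "w \<noteq> y" using permutes_orbit_subset[OF \<tau>, of z] z w by auto
    moreover have "w \<noteq> x"
      using z w permutes_orbit_eqI[OF fin' \<tau>] permutes_self_in_orbit[OF fin' \<tau>] by blast
    ultimately show "\<tau> w = \<sigma> w" by (simp add: insert_point_apply)
  qed
  then show ?thesis unfolding eq by (auto intro!: image_cong)
qed

end

text \<open>The transposition is an involution, so the same composition deletes the point again: it
  sends \<open>y\<close> to \<open>\<sigma> x = y\<close>.\<close>

lemma insert_point_bij:
  assumes "x \<in> S" "y \<in> S" "x \<noteq> y"
  shows "bij_betw (\<lambda>\<tau>. \<tau> \<circ> Transposition.transpose x y) {\<tau>. \<tau> permutes (S - {y})} {\<sigma>. \<sigma> permutes S \<and> \<sigma> x = y}"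
proof (rule bij_betw_byWitness[where f' = "\<lambda>\<sigma>. \<sigma> \<circ> Transposition.transpose x y"])
  show "(\<lambda>\<tau>. \<tau> \<circ> Transposition.transpose x y) ` {\<tau>. \<tau> permutes (S - {y})} \<subseteq> {\<sigma>. \<sigma> permutes S \<and> \<sigma> x = y}"
    using assms by (auto simp: permutes_not_in
        intro!: permutes_compose permutes_swap_id intro: permutes_subset)
  show "(\<lambda>\<sigma>. \<sigma> \<circ> Transposition.transpose x y) ` {\<sigma>. \<sigma> permutes S \<and> \<sigma> x = y} \<subseteq> {\<tau>. \<tau> permutes (S - {y})}"
  proof clarsimp
    fix \<sigma> assume "\<sigma> permutes S" "y = \<sigma> x"
    then have "\<sigma> \<circ> Transposition.transpose x y permutes S"
      using assms by (intro permutes_compose permutes_swap_id) auto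
    then show "(\<sigma> \<circ> Transposition.transpose x (\<sigma> x)) permutes (S - {\<sigma> x})"
      unfolding \<open>y = \<sigma> x\<close> by (rule permutes_superset) auto
  qed
qed (auto simp: fun_eq_iff)

text \<open>Induction on \<open>l\<close> by deleting the successor \<open>\<sigma> x\<close> of
  \<open>x\<close>. The argument of \<open>\<Psi>\<close> consists of the cycles avoiding
  \<open>x\<close>, which the deletion leaves alone, and the successive choices of successors
  multiply to (n-1)(n-2)...(n-l+1) with n = \<open>card S\<close>.\<close>

lemma sum_permutes_orbit_card:
  fixes \<Psi> :: "nat multiset \<Rightarrow> real"
  assumes "finite S" "x \<in> S" "1 \<le> l" "l \<le> card S"
    and "\<And>T. T \<subseteq> S \<Longrightarrow> card T = card S - l \<Longrightarrow>
           (\<Sum>\<sigma> | \<sigma> permutes T. \<Psi> (cyc_lens T \<sigma>)) = C"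
  shows "(\<Sum>\<sigma> | \<sigma> permutes S \<and> card (orbit \<sigma> x) = l.
            \<Psi> (image_mset card (mset_set (orbit \<sigma> ` (S - orbit \<sigma> x)))))
         = fact (card S - 1) / fact (card S - l) * C"
  using assms(3,1,2,4,5)
proof (induction l arbitrary: S rule: dec_induct)
  case base
  have eq: "{\<sigma>. \<sigma> permutes S \<and> card (orbit \<sigma> x) = 1} = {\<sigma>. \<sigma> permutes (S - {x})}"
  proof (intro set_eqI iffI; clarsimp)
    fix \<sigma> assume \<sigma>: "\<sigma> permutes S" "card (orbit \<sigma> x) = Suc 0"
    then have "orbit \<sigma> x = {x}"
      using permutes_self_in_orbit[OF base(1) \<sigma>(1), of x] by (metis card_1_singletonE One_nat_def singletonD)
    then have "\<sigma> x = x" by (simp add: orbit_eq_singleton_iff)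
    then show "\<sigma> permutes (S - {x})" using \<sigma>(1) by (auto intro!: permutes_superset[OF \<sigma>(1)])
  next
    fix \<sigma> assume \<sigma>: "\<sigma> permutes (S - {x})"
    then have "\<sigma> x = x" by (simp add: permutes_not_in)
    then show "\<sigma> permutes S \<and> card (orbit \<sigma> x) = Suc 0"
      using permutes_subset[OF \<sigma>, of S] by (simp add: orbit_eq_singleton_iff[symmetric])
  qed
  have "(\<Sum>\<sigma> | \<sigma> permutes S \<and> card (orbit \<sigma> x) = 1.
            \<Psi> (image_mset card (mset_set (orbit \<sigma> ` (S - orbit \<sigma> x)))))
     = (\<Sum>\<sigma> | \<sigma> permutes (S - {x}). \<Psi> (cyc_lens (S - {x}) \<sigma>))"
    unfolding eq
  proof (rule sum.cong[OF refl])
    fix \<sigma> assume "\<sigma> \<in> {\<sigma>. \<sigma> permutes (S - {x})}"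
    then have "orbit \<sigma> x = {x}" by (simp add: permutes_not_in orbit_eq_singleton_iff)
    then show "\<Psi> (image_mset card (mset_set (orbit \<sigma> ` (S - orbit \<sigma> x)))) = \<Psi> (cyc_lens (S - {x}) \<sigma>)"
      by (simp add: cyc_lens_def)
  qed
  also have "\<dots> = C" using base by simp
  finally show ?case by simp
next
  case (step l)
  let ?O = "\<lambda>S \<sigma>. \<Psi> (image_mset card (mset_set (orbit \<sigma> ` (S - orbit \<sigma> x))))"
  let ?A = "\<lambda>y. {\<sigma>. \<sigma> permutes S \<and> card (orbit \<sigma> x) = Suc l \<and> \<sigma> x = y}"
  have fin: "finite {\<sigma>. \<sigma> permutes S}" using step.prems(1) by (rule finite_permutations)
  have "{\<sigma>. \<sigma> permutes S \<and> card (orbit \<sigma> x) = Suc l} = (\<Union>y\<in>S - {x}. ?A y)"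
  proof (intro set_eqI iffI; clarsimp)
    fix \<sigma> assume \<sigma>: "\<sigma> permutes S" "card (orbit \<sigma> x) = Suc l"
    have "\<sigma> x \<noteq> x"
    proof
      assume "\<sigma> x = x"
      then have "orbit \<sigma> x = {x}" by (simp add: orbit_eq_singleton_iff)
      then show False using \<sigma> step.hyps by simp
    qed
    then show "\<sigma> x \<in> S \<and> \<sigma> x \<noteq> x" using \<sigma>(1) step.prems(2) by (simp add: permutes_in_image)
  qed
  then have "(\<Sum>\<sigma> | \<sigma> permutes S \<and> card (orbit \<sigma> x) = Suc l. ?O S \<sigma>)
     = (\<Sum>\<sigma> \<in> (\<Union>y\<in>S - {x}. ?A y). ?O S \<sigma>)" by simp
  also have "\<dots> = (\<Sum>y\<in>S - {x}. \<Sum>\<sigma>\<in>?A y. ?O S \<sigma>)"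
    using step.prems(1) fin by (intro sum.UNION_disjoint) (auto elim!: rev_finite_subset)
  \<comment> \<open>Every successor \<open>y\<close> contributes the same amount, namely the
    induction hypothesis for \<open>S - {y}\<close>, where both the ground set and the cycle are
    smaller by one.\<close>
  also have "\<dots> = (\<Sum>y\<in>S - {x}. fact (card S - 2) / fact (card S - Suc l) * C)"
  proof (rule sum.cong[OF refl])
    fix y assume y: "y \<in> S - {x}"
    then have xy: "x \<in> S" "y \<in> S" "x \<noteq> y" using step.prems by auto
    note fS = step.prems(1)
    let ?B = "{\<tau>. \<tau> permutes (S - {y}) \<and> card (orbit \<tau> x) = l}"
    have card_eq: "card (orbit (\<tau> \<circ> Transposition.transpose x y) x) = Suc (card (orbit \<tau> x))"
      if \<tau>: "\<tau> permutes (S - {y})" for \<tau>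
    proof -
      have "finite (orbit \<tau> x)"
        by (rule finite_subset[OF permutes_orbit_subset[OF \<tau>]]) (use fS xy in auto)
      then show ?thesis
        using insert_point_orbit[OF fS xy \<tau> refl] insert_point_notin[OF fS xy \<tau> refl] by simp
    qed
    have img: "?A y = (\<lambda>\<tau>. \<tau> \<circ> Transposition.transpose x y) ` ?B"
    proof -
      have "?A y = {\<sigma> \<in> {\<sigma>. \<sigma> permutes S \<and> \<sigma> x = y}. card (orbit \<sigma> x) = Suc l}" by auto
      also have "\<dots> = (\<lambda>\<tau>. \<tau> \<circ> Transposition.transpose x y) ` ?B"
        using bij_betw_imp_surj_on[OF insert_point_bij[OF xy], symmetric]
        by (auto simp: card_eq)
      finally show ?thesis .
    qed
    have inj: "inj_on (\<lambda>\<tau>. \<tau> \<circ> Transposition.transpose x y) ?B"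
      by (rule inj_on_subset[OF bij_betw_imp_inj_on[OF insert_point_bij[OF xy]]]) auto
    have "(\<Sum>\<sigma>\<in>?A y. ?O S \<sigma>) = (\<Sum>\<tau>\<in>?B. ?O S (\<tau> \<circ> Transposition.transpose x y))"
      unfolding img using inj by (simp add: sum.reindex)
    also have "\<dots> = (\<Sum>\<tau>\<in>?B. ?O (S - {y}) \<tau>)"
      using insert_point_other_orbits[OF fS xy _ refl] by (intro sum.cong) auto
    also have "\<dots> = fact (card (S - {y}) - 1) / fact (card (S - {y}) - l) * C"
      using step.prems xy by (intro step.IH) auto
    also have "\<dots> = fact (card S - 2) / fact (card S - Suc l) * C"
      using fS xy by (simp add: numeral_2_eq_2)
    finally show "(\<Sum>\<sigma>\<in>?A y. ?O S \<sigma>) = fact (card S - 2) / fact (card S - Suc l) * C" .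
  qed
  also have "\<dots> = fact (card S - 1) / fact (card S - Suc l) * C"
  proof -
    have "card S - 1 = Suc (card S - 2)" using step by linarith
    moreover have "card (S - {x}) = card S - 1" using step.prems by simp
    ultimately show ?thesis by simp
  qed
  finally show ?case .
qed

lemma sum_permutes_orbit_cyc_lens:
  fixes \<Phi> :: "nat multiset \<Rightarrow> real"
  assumes "finite S" "x \<in> S" "1 \<le> l" "l \<le> card S"
    and "\<And>T. T \<subseteq> S \<Longrightarrow> card T = card S - l \<Longrightarrow>
           (\<Sum>\<sigma> | \<sigma> permutes T. \<Phi> (add_mset l (cyc_lens T \<sigma>))) = C"
  shows "(\<Sum>\<sigma> | \<sigma> permutes S \<and> card (orbit \<sigma> x) = l. \<Phi> (cyc_lens S \<sigma>))
         = fact (card S - 1) / fact (card S - l) * C"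
proof -
  have "(\<Sum>\<sigma> | \<sigma> permutes S \<and> card (orbit \<sigma> x) = l. \<Phi> (cyc_lens S \<sigma>))
     = (\<Sum>\<sigma> | \<sigma> permutes S \<and> card (orbit \<sigma> x) = l.
          \<Phi> (add_mset l (image_mset card (mset_set (orbit \<sigma> ` (S - orbit \<sigma> x))))))"
    using assms(1,2) by (intro sum.cong) (auto simp: cyc_lens_remove)
  also have "\<dots> = fact (card S - 1) / fact (card S - l) * C"
    by (rule sum_permutes_orbit_card[where \<Psi> = "\<lambda>M. \<Phi> (add_mset l M)", OF assms])
  finally show ?thesis .
qed

lemma sum_permutes_by_orbit_card:
  fixes F :: "('a \<Rightarrow> 'a) \<Rightarrow> real"
  assumes "finite S" "x \<in> S"
  shows "(\<Sum>\<sigma> | \<sigma> permutes S. F \<sigma>) =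
    (\<Sum>l = 1..card S. \<Sum>\<sigma> | \<sigma> permutes S \<and> card (orbit \<sigma> x) = l. F \<sigma>)"
proof -
  have fin: "finite {\<sigma>. \<sigma> permutes S}" using assms(1) by (rule finite_permutations)
  have "(\<lambda>\<sigma>. card (orbit \<sigma> x)) ` {\<sigma>. \<sigma> permutes S} \<subseteq> {1..card S}"
  proof clarsimp
    fix \<sigma> assume \<sigma>: "\<sigma> permutes S"
    note sub = permutes_orbit_subset[OF \<sigma> assms(2)]
    have "finite (orbit \<sigma> x)" using finite_subset[OF sub assms(1)] .
    then have "card (orbit \<sigma> x) > 0" by (simp add: card_gt_0_iff orbit_nonempty)
    then show "Suc 0 \<le> card (orbit \<sigma> x) \<and> card (orbit \<sigma> x) \<le> card S"
      using card_mono[OF assms(1) sub] by simp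
  qed
  then have "(\<Sum>l = 1..card S. sum F {\<sigma> \<in> {\<sigma>. \<sigma> permutes S}. card (orbit \<sigma> x) = l}) = sum F {\<sigma>. \<sigma> permutes S}"
    by (intro sum.group fin) auto
  then show ?thesis by simp
qed

section \<open>Cycle counts and the recursion\<close>

text \<open>The coefficients of \<open>H = exp (\<Sum>j. x j / j * z ^ j)\<close>; the recursion is
  z H' = X H read off coefficientwise, where X is the generating function of \<open>x j\<close> for
  j >= 1.\<close>

fun hseq :: "(nat \<Rightarrow> real) \<Rightarrow> nat \<Rightarrow> real" where
  "hseq x n = (if n = 0 then 1 else (\<Sum>i<n. x (n - i) * hseq x i) / real n)"

declare hseq.simps [simp del]

lemma hseq_0 [simp]: "hseq x 0 = 1"
  by (simp add: hseq.simps)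

lemma hseq_rec: "real n * hseq x n = (\<Sum>j = 1..n. x j * hseq x (n - j))"
proof (cases "n = 0")
  case False
  have "real n * hseq x n = (\<Sum>i<n. x (n - i) * hseq x i)"
    using False by (subst hseq.simps) simp
  also have "\<dots> = (\<Sum>j = 1..n. x j * hseq x (n - j))"
    by (rule sum.reindex_bij_witness[of _ "\<lambda>j. n - j" "\<lambda>i. n - i"]) auto
  finally show ?thesis .
qed simp

lemma hseq_pos:
  assumes "\<And>j. j \<ge> 1 \<Longrightarrow> x j > 0"
  shows "hseq x n > 0"
proof (induction n rule: less_induct)
  case (less n)
  show ?case
  proof (cases "n = 0")
    case False
    have "real n * hseq x n > 0"
      unfolding hseq_rec using False less assms by (intro sum_pos mult_pos_pos) auto
    then show ?thesis by (simp add: zero_less_mult_iff)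
  qed simp
qed

section \<open>Permutations with prescribed numbers of short cycles\<close>

definition parts_coeff :: "(nat \<Rightarrow> real) \<Rightarrow> nat \<Rightarrow> (nat \<Rightarrow> nat) \<Rightarrow> real" where
  "parts_coeff \<theta> m k = (\<Prod>j\<in>{1..m}. (\<theta> j / real j) ^ k j / fact (k j))"

definition parts_size :: "nat \<Rightarrow> (nat \<Rightarrow> nat) \<Rightarrow> nat" where
  "parts_size m k = (\<Sum>j\<in>{1..m}. j * k j)"

text \<open>The coefficient of z^n in the product over j <= m of
  \<open>(\<theta> j / j * z ^ j) ^ k j / fact (k j)\<close>, times the exponential of the series
  restricted to j > m. It is the closed form to be matched with permutations having
  \<open>k j\<close> cycles of length j for each j <= m.\<close>

definition parts_seq :: "(nat \<Rightarrow> real) \<Rightarrow> nat \<Rightarrow> (nat \<Rightarrow> nat) \<Rightarrow> nat \<Rightarrow> real" where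
  "parts_seq \<theta> m k n = parts_coeff \<theta> m k *
     (if parts_size m k \<le> n then hseq (\<lambda>j. if j \<le> m then 0 else \<theta> j) (n - parts_size m k) else 0)"

lemma parts_coeff_decr:
  assumes "l \<in> {1..m}" "k l > 0"
  shows "\<theta> l * parts_coeff \<theta> m (k(l := k l - 1)) = real (l * k l) * parts_coeff \<theta> m k"
proof -
  let ?f = "\<lambda>k j. (\<theta> j / real j) ^ k j / fact (k j)"
  have "parts_coeff \<theta> m (k(l := k l - 1)) = ?f (k(l := k l - 1)) l * (\<Prod>j\<in>{1..m} - {l}. ?f (k(l := k l - 1)) j)"
    unfolding parts_coeff_def by (rule prod.remove) (use assms in auto)
  also have "(\<Prod>j\<in>{1..m} - {l}. ?f (k(l := k l - 1)) j) = (\<Prod>j\<in>{1..m} - {l}. ?f k j)"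
    by (rule prod.cong) auto
  finally have 1: "parts_coeff \<theta> m (k(l := k l - 1)) = (\<theta> l / real l) ^ (k l - 1) / fact (k l - 1) * (\<Prod>j\<in>{1..m} - {l}. ?f k j)"
    unfolding fun_upd_same .
  have 2: "parts_coeff \<theta> m k = ?f k l * (\<Prod>j\<in>{1..m} - {l}. ?f k j)"
    unfolding parts_coeff_def by (rule prod.remove) (use assms in auto)
  obtain q where q: "k l = Suc q" using assms(2) by (cases "k l") auto
  define t where "t = \<theta> l / real l"
  have "\<theta> l = real l * t" using assms by (simp add: t_def)
  then show ?thesis unfolding 1 2 unfolding q t_def[symmetric]
    by (simp add: divide_simps del: of_nat_Suc) (simp add: algebra_simps)
qed

lemma parts_size_decr:
  assumes "l \<in> {1..m}" "k l > 0"
  shows "parts_size m (k(l := k l - 1)) + l = parts_size m k"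
proof -
  have "parts_size m (k(l := k l - 1)) = l * (k l - 1) + (\<Sum>j\<in>{1..m} - {l}. j * (k(l := k l - 1)) j)"
    unfolding parts_size_def by (subst sum.remove[of _ l]) (use assms in \<open>auto simp del: fun_upd_apply simp: fun_upd_same\<close>)
  also have "(\<Sum>j\<in>{1..m} - {l}. j * (k(l := k l - 1)) j) = (\<Sum>j\<in>{1..m} - {l}. j * k j)"
    by (rule sum.cong) auto
  finally have 1: "parts_size m (k(l := k l - 1)) = l * (k l - 1) + (\<Sum>j\<in>{1..m} - {l}. j * k j)" .
  have 2: "parts_size m k = l * k l + (\<Sum>j\<in>{1..m} - {l}. j * k j)"
    unfolding parts_size_def by (subst sum.remove[of _ l]) (use assms in auto)
  obtain q where q: "k l = Suc q" using assms(2) by (cases "k l") auto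
  show ?thesis unfolding 1 2 unfolding q by simp
qed

lemma parts_size_ge:
  assumes "l \<in> {1..m}" "k l > 0"
  shows "l \<le> parts_size m k"
  using parts_size_decr[where l=l and m=m and k=k] assms by linarith

text \<open>A removed cycle either uses up one of the \<open>k l\<close> prescribed short cycles or
  belongs to the unconstrained long part. By \<open>parts_coeff_decr\<close> the first kind
  contributes \<open>parts_size m k\<close> times the value, by \<open>hseq_rec\<close> the second
  kind \<open>n - parts_size m k\<close> times.\<close>

lemma parts_seq_rec:
  "real n * parts_seq \<theta> m k n = (\<Sum>l = 1..n. \<theta> l *
     (if l \<le> m then if k l = 0 then 0 else parts_seq \<theta> m (k(l := k l - 1)) (n - l)
      else parts_seq \<theta> m k (n - l)))" (is "_ = (\<Sum>l = 1..n. ?t l)")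
proof (cases "parts_size m k \<le> n")
  case False
  have "?t l = 0" if l: "l \<in> {1..n}" for l
    using parts_size_decr[where l=l and m=m and k=k] l False by (auto simp: parts_seq_def)
  then have "(\<Sum>l = 1..n. ?t l) = 0" by (intro sum.neutral) blast
  then show ?thesis using False by (simp add: parts_seq_def)
next
  case True
  let ?c = "parts_coeff \<theta> m k" and ?s = "parts_size m k"
  let ?y = "\<lambda>j. if j \<le> m then 0 else \<theta> j"
  let ?A = "\<lambda>l. if l \<le> m then ?c * real (l * k l) * hseq ?y (n - ?s) else 0"
  let ?B = "\<lambda>l. if l \<le> n - ?s then ?c * (?y l * hseq ?y (n - ?s - l)) else 0"
  have "?t l = ?A l + ?B l" if l: "l \<in> {1..n}" for l
  proof (cases "l \<le> m")
    case lm: True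
    show ?thesis
    proof (cases "k l = 0")
      case False
      have lm': "l \<in> {1..m}" using l lm by auto
      define k' where "k' = k(l := k l - 1)"
      have 1: "\<theta> l * parts_coeff \<theta> m k' = real (l * k l) * ?c"
        unfolding k'_def using lm' False by (intro parts_coeff_decr) auto
      have 2: "parts_size m k' + l = ?s"
        unfolding k'_def using lm' False by (intro parts_size_decr) auto
      have "parts_size m k' \<le> n - l" using 2 True by linarith
      then have "\<theta> l * parts_seq \<theta> m k' (n - l) = (\<theta> l * parts_coeff \<theta> m k') * hseq ?y (n - l - parts_size m k')"
        unfolding parts_seq_def by simp
      also have "n - l - parts_size m k' = n - ?s"
        using 2 by simp
      also note 1
      finally show ?thesis using lm False by (simp add: k'_def mult_ac del: fun_upd_apply)
    qed (use lm in auto)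
  next
    case False
    then show ?thesis using True l
      by (auto simp: parts_seq_def algebra_simps diff_diff_eq add.commute)
  qed
  then have "(\<Sum>l = 1..n. ?t l) = (\<Sum>l = 1..n. ?A l) + (\<Sum>l = 1..n. ?B l)"
    by (simp add: sum.distrib)
  also have "(\<Sum>l = 1..n. ?A l) = (\<Sum>l = 1..m. ?c * real (l * k l) * hseq ?y (n - ?s))"
  proof (rule sum.mono_neutral_cong)
    \<comment> \<open>For l > n the factor \<open>k l\<close> vanishes, because
      \<open>k l > 0\<close> would force \<open>l <= parts_size m k <= n\<close>.\<close>
    fix l assume "l \<in> {1..m} - {1..n}"
    then show "?c * real (l * k l) * hseq ?y (n - ?s) = 0"
      using True parts_size_ge[where l=l and m=m and k=k] by fastforce
  qed auto
  also have "\<dots> = ?c * real ?s * hseq ?y (n - ?s)"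
    unfolding parts_size_def by (simp add: sum_distrib_left sum_distrib_right)
  also have "(\<Sum>l = 1..n. ?B l) = (\<Sum>l = 1..n - ?s. ?c * (?y l * hseq ?y (n - ?s - l)))"
    by (rule sum.mono_neutral_cong_right) auto
  also have "\<dots> = ?c * (real (n - ?s) * hseq ?y (n - ?s))"
    unfolding hseq_rec by (simp add: sum_distrib_left)
  also have "?c * real ?s * hseq ?y (n - ?s) + \<dots> = real n * parts_seq \<theta> m k n"
    using True by (simp add: parts_seq_def of_nat_diff algebra_simps)
  finally show ?thesis ..
qed

text \<open>Both sides satisfy the same recursion: split by the length \<open>l\<close> of the cycle
  through an arbitrary point and remove that cycle. This lowers the requirement at \<open>l\<close>
  by one when l <= m, so the induction must range over all \<open>k\<close>.\<close>

lemma sum_permutes_parts: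
  assumes "finite S"
  shows "(\<Sum>\<sigma> | \<sigma> permutes S. if \<forall>j\<in>{1..m}. count (cyc_lens S \<sigma>) j = k j
            then prod_mset (image_mset \<theta> (cyc_lens S \<sigma>)) else 0)
         = fact (card S) * parts_seq \<theta> m k (card S)"
  using assms
proof (induction "card S" arbitrary: S k rule: less_induct)
  case less
  let ?\<Phi> = "\<lambda>k M. if \<forall>j\<in>{1..m}. count M j = k j then prod_mset (image_mset \<theta> M) else 0"
  show ?case
  proof (cases "S = {}")
    case True
    have cl: "cyc_lens S \<sigma> = {#}" for \<sigma> using True by (simp add: cyc_lens_def)
    have id: "{\<sigma>. \<sigma> permutes S} = {id}" using True by simp
    have "parts_seq \<theta> m k 0 = (if \<forall>j\<in>{1..m}. k j = 0 then 1 else 0)"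
      by (auto simp: parts_seq_def parts_size_def parts_coeff_def intro!: prod.neutral)
    then show ?thesis unfolding cl id using True by auto
  next
    case False
    then obtain x where x: "x \<in> S" by auto
    let ?n = "card S"
    have n: "?n > 0" using less.prems x by (auto simp: card_gt_0_iff)
    let ?t = "\<lambda>l. \<theta> l * (if l \<le> m then if k l = 0 then 0 else parts_seq \<theta> m (k(l := k l - 1)) (?n - l)
      else parts_seq \<theta> m k (?n - l))"
    have "(\<Sum>\<sigma> | \<sigma> permutes S. ?\<Phi> k (cyc_lens S \<sigma>)) =
       (\<Sum>l = 1..?n. \<Sum>\<sigma> | \<sigma> permutes S \<and> card (orbit \<sigma> x) = l. ?\<Phi> k (cyc_lens S \<sigma>))"
      by (rule sum_permutes_by_orbit_card[OF less.prems x])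
    also have "\<dots> = (\<Sum>l = 1..?n. fact (?n - 1) * ?t l)"
    proof (rule sum.cong[OF refl])
      fix l assume l: "l \<in> {1..?n}"
      have "(\<Sum>\<sigma> | \<sigma> permutes S \<and> card (orbit \<sigma> x) = l. ?\<Phi> k (cyc_lens S \<sigma>))
         = fact (?n - 1) / fact (?n - l) * (fact (?n - l) * ?t l)"
      proof (rule sum_permutes_orbit_cyc_lens[OF less.prems x])
        fix T assume T: "T \<subseteq> S" "card T = ?n - l"
        have IH: "(\<Sum>\<sigma> | \<sigma> permutes T. ?\<Phi> k' (cyc_lens T \<sigma>)) = fact (?n - l) * parts_seq \<theta> m k' (?n - l)" for k'
          unfolding T(2)[symmetric]
          using less.prems T l n by (intro less.hyps) (auto intro: finite_subset)
        have step: "?\<Phi> k (add_mset l M) = \<theta> l * (if l \<le> m then if k l = 0 then 0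
             else ?\<Phi> (k(l := k l - 1)) M else ?\<Phi> k M)" for M
        proof (cases "l \<le> m \<and> k l \<noteq> 0")
          case True
          then have "(\<forall>j\<in>{1..m}. count (add_mset l M) j = k j)
             \<longleftrightarrow> (\<forall>j\<in>{1..m}. count M j = (k(l := k l - 1)) j)"
            using l by (intro ball_cong) auto
          then show ?thesis using True by auto
        next
          case False
          then consider "l > m" | "l \<le> m" "k l = 0" by linarith
          then show ?thesis
          proof cases
            case 1
            then have "(\<forall>j\<in>{1..m}. count (add_mset l M) j = k j) \<longleftrightarrow> (\<forall>j\<in>{1..m}. count M j = k j)"
              by (intro ball_cong) auto
            then show ?thesis using 1 by auto
          next
            case 2
            then have "\<not> (\<forall>j\<in>{1..m}. count (add_mset l M) j = k j)"
              using l by (auto intro!: bexI[of _ l])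
            then have "?\<Phi> k (add_mset l M) = 0" by (rule if_not_P)
            moreover have "\<theta> l * (if l \<le> m then if k l = 0 then 0
               else ?\<Phi> (k(l := k l - 1)) M else ?\<Phi> k M) = 0" using 2 by simp
            ultimately show ?thesis by (rule trans[OF _ sym])
          qed
        qed
        have "(\<Sum>\<sigma> | \<sigma> permutes T. ?\<Phi> k (add_mset l (cyc_lens T \<sigma>))) =
          \<theta> l * (if l \<le> m then if k l = 0 then 0
             else (\<Sum>\<sigma> | \<sigma> permutes T. ?\<Phi> (k(l := k l - 1)) (cyc_lens T \<sigma>))
           else (\<Sum>\<sigma> | \<sigma> permutes T. ?\<Phi> k (cyc_lens T \<sigma>)))"
          unfolding step sum_distrib_left[symmetric]
          by (cases "l \<le> m"; cases "k l = 0")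
            (simp_all only: if_True if_False sum.neutral_const simp_thms)
        also have "\<dots> = fact (?n - l) * ?t l"
          unfolding IH by simp
        finally show "(\<Sum>\<sigma> | \<sigma> permutes T. ?\<Phi> k (add_mset l (cyc_lens T \<sigma>))) = fact (?n - l) * ?t l" .
      qed (use l in auto)
      then show "(\<Sum>\<sigma> | \<sigma> permutes S \<and> card (orbit \<sigma> x) = l. ?\<Phi> k (cyc_lens S \<sigma>)) = fact (?n - 1) * ?t l"
        by simp
    qed
    also have "\<dots> = fact (?n - 1) * (real ?n * parts_seq \<theta> m k ?n)"
      unfolding parts_seq_rec by (simp add: sum_distrib_left)
    also have "\<dots> = fact ?n * parts_seq \<theta> m k ?n"
      using n by (simp add: fact_reduce)
    finally show ?thesis .
  qed
qed

text \<open>With \<open>m = 0\<close> nothing is prescribed, so the sum over all permutations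
  becomes an instance of \<open>sum_permutes_parts\<close>.\<close>

lemma parts_seq_0 [simp]: "parts_seq \<theta> 0 k n = hseq \<theta> n"
proof -
  have "hseq (\<lambda>j. if j = 0 then 0 else \<theta> j) n = hseq \<theta> n"
    by (induction n rule: less_induct) (subst (1 2) hseq.simps, auto intro!: sum.cong)
  then show ?thesis by (simp add: parts_seq_def parts_size_def parts_coeff_def)
qed

lemma sum_permutes_hseq:
  assumes "finite S"
  shows "(\<Sum>\<sigma> | \<sigma> permutes S. prod_mset (image_mset \<theta> (cyc_lens S \<sigma>))) = fact (card S) * hseq \<theta> (card S)"
  using sum_permutes_parts[OF assms, of 0 "\<lambda>_. 0" \<theta>] by simp

lemma sum_permutes_orbit_hseq:
  assumes "finite S" "x \<in> S" "1 \<le> l" "l \<le> card S"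
  shows "(\<Sum>\<sigma> | \<sigma> permutes S \<and> card (orbit \<sigma> x) = l. prod_mset (image_mset \<theta> (cyc_lens S \<sigma>)))
     = fact (card S - 1) * (\<theta> l * hseq \<theta> (card S - l))"
proof -
  have "(\<Sum>\<sigma> | \<sigma> permutes S \<and> card (orbit \<sigma> x) = l. prod_mset (image_mset \<theta> (cyc_lens S \<sigma>)))
     = fact (card S - 1) / fact (card S - l) * (\<theta> l * (fact (card S - l) * hseq \<theta> (card S - l)))"
    using assms
    by (intro sum_permutes_orbit_cyc_lens[where \<Phi> = "\<lambda>M. prod_mset (image_mset \<theta> M)"])
      (auto simp: sum_permutes_hseq finite_subset simp flip: sum_distrib_left)
  then show ?thesis by simp
qed

section \<open>Probabilities and expectations in terms of \<open>hseq\<close>\<close>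

lemma count_cyc_lens: "finite S \<Longrightarrow> count (cyc_lens S \<sigma>) j = card {c \<in> orbit \<sigma> ` S. card c = j}"
  unfolding cyc_lens_def by (simp add: count_image_mset vimage_def Int_def conj_commute)

lemma cyc_count_eq: "cyc_count n \<sigma> j = count (cyc_lens {1..n} \<sigma>) j"
  unfolding count_cyc_lens[OF finite_atLeastAtMost] cyc_count_def by (rule arg_cong[where f = card]) auto

lemma set_cyc_lens:
  assumes "\<sigma> permutes S" "finite S"
  shows "set_mset (cyc_lens S \<sigma>) \<subseteq> {1..card S}"
proof -
  have "1 \<le> card (orbit \<sigma> i) \<and> card (orbit \<sigma> i) \<le> card S" if "i \<in> S" for i
    using permutes_orbit_subset[OF assms(1) that] assms(2) finite_subset card_mono
    by (metis card_gt_0_iff orbit_nonempty Suc_leI One_nat_def)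
  then show ?thesis using assms(2) by (auto simp: cyc_lens_def)
qed

lemma weight_eq:
  assumes "\<sigma> permutes {1..n}"
  shows "weight \<theta> n \<sigma> = prod_mset (image_mset \<theta> (cyc_lens {1..n} \<sigma>))"
proof -
  have "prod_mset (image_mset \<theta> (cyc_lens {1..n} \<sigma>)) =
     (\<Prod>j\<in>set_mset (cyc_lens {1..n} \<sigma>). \<theta> j ^ count (cyc_lens {1..n} \<sigma>) j)"
    by (rule image_prod_mset_multiplicity)
  also have "\<dots> = (\<Prod>j\<in>{1..n}. \<theta> j ^ count (cyc_lens {1..n} \<sigma>) j)"
    using set_cyc_lens[OF assms] by (intro prod.mono_neutral_left) (auto simp: not_in_iff)
  finally show ?thesis by (simp add: weight_def cyc_count_eq)
qed

lemma h_n_eq: "h_n \<theta> n = hseq \<theta> n"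
proof -
  have "(\<Sum>\<sigma>\<in>perms n. weight \<theta> n \<sigma>) = (\<Sum>\<sigma> | \<sigma> permutes {1..n}. prod_mset (image_mset \<theta> (cyc_lens {1..n} \<sigma>)))"
    unfolding perms_def by (intro sum.cong) (auto simp: weight_eq)
  then show ?thesis by (simp add: h_n_def sum_permutes_hseq)
qed

text \<open>The law of the length of the cycle through a given point, whichever point it is; see
  \<open>sum_weight_orbit_card\<close>.\<close>

definition len_prob :: "(nat \<Rightarrow> real) \<Rightarrow> nat \<Rightarrow> nat \<Rightarrow> real" where
  "len_prob \<theta> n l = \<theta> l * hseq \<theta> (n - l) / (real n * hseq \<theta> n)"

lemma sum_weight_orbit_card:
  assumes "i \<in> {1..n}" "l \<in> {1..n}"
  shows "(\<Sum>\<sigma> | \<sigma> permutes {1..n} \<and> card (orbit \<sigma> i) = l. weight \<theta> n \<sigma> / (fact n * h_n \<theta> n)) = len_prob \<theta> n l"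
proof -
  have "(\<Sum>\<sigma> | \<sigma> permutes {1..n} \<and> card (orbit \<sigma> i) = l. weight \<theta> n \<sigma>)
     = fact (n - 1) * (\<theta> l * hseq \<theta> (n - l))"
    using sum_permutes_orbit_hseq[of "{1..n}" i l \<theta>] assms by (simp add: weight_eq)
  moreover have "fact n = real n * fact (n - 1)"
    using assms by (intro fact_reduce) simp
  ultimately show ?thesis
    by (simp add: h_n_eq len_prob_def flip: sum_divide_distrib)
qed

lemma expectation_orbit_card:
  assumes "i \<in> {1..n}"
  shows "En \<theta> n (\<lambda>\<sigma>. f (card (orbit \<sigma> i))) = (\<Sum>l = 1..n. f l * len_prob \<theta> n l)"
proof -
  have "En \<theta> n (\<lambda>\<sigma>. f (card (orbit \<sigma> i))) = (\<Sum>l = 1..n.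
     \<Sum>\<sigma> | \<sigma> permutes {1..n} \<and> card (orbit \<sigma> i) = l. f (card (orbit \<sigma> i)) * weight \<theta> n \<sigma> / (fact n * h_n \<theta> n))"
    unfolding En_def perms_def using assms by (subst sum_permutes_by_orbit_card[of _ i]) auto
  also have "\<dots> = (\<Sum>l = 1..n. f l * (\<Sum>\<sigma> | \<sigma> permutes {1..n} \<and> card (orbit \<sigma> i) = l. weight \<theta> n \<sigma> / (fact n * h_n \<theta> n)))"
    unfolding sum_distrib_left by (intro sum.cong) auto
  also have "\<dots> = (\<Sum>l = 1..n. f l * len_prob \<theta> n l)"
    by (intro sum.cong refl arg_cong2[where f = "(*)"] sum_weight_orbit_card assms)
  finally show ?thesis .
qed

lemma prob_cyc_len1:
  assumes "n \<ge> 1"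
  shows "Pn \<theta> n {\<sigma>. Q (cyc_len1 \<sigma>)} = (\<Sum>l = 1..n. of_bool (Q l) * len_prob \<theta> n l)"
proof -
  have "finite (perms n)" unfolding perms_def by (rule finite_permutations) simp
  then have "Pn \<theta> n {\<sigma>. Q (cyc_len1 \<sigma>)} = En \<theta> n (\<lambda>\<sigma>. of_bool (Q (card (orbit \<sigma> 1))))"
    unfolding Pn_def En_def cyc_len1_def by (intro sum.mono_neutral_cong_left) auto
  also have "\<dots> = (\<Sum>l = 1..n. of_bool (Q l) * len_prob \<theta> n l)"
    using assms by (intro expectation_orbit_card) simp
  finally show ?thesis .
qed

text \<open>A cycle of length l is met by l points, each contributing 1/l. This reduces the mean
  number of cycles to the mean of 1 / \<open>L1\<close>.\<close>

lemma num_cycles_eq: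
  assumes "\<sigma> permutes {1..n}"
  shows "real (num_cycles n \<sigma>) = (\<Sum>i = 1..n. 1 / real (card (orbit \<sigma> i)))"
proof -
  have "1 = (\<Sum>i\<in>{i \<in> {1..n}. orbit \<sigma> i = c}. 1 / real (card (orbit \<sigma> i)))"
    if c: "c \<in> orbit \<sigma> ` {1..n}" for c
  proof -
    from c obtain x where x: "x \<in> {1..n}" "c = orbit \<sigma> x" by auto
    have c_sub: "c \<subseteq> {1..n}" using permutes_orbit_subset[OF assms x(1)] x(2) by simp
    then have "card c > 0"
      using x(2) finite_subset[OF c_sub] by (simp add: card_gt_0_iff orbit_nonempty)
    moreover have "{i \<in> {1..n}. orbit \<sigma> i = c} = c"
      using c_sub x(2) permutes_orbit_eqI[OF _ assms] permutes_self_in_orbit[OF _ assms] by blast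
    moreover have "(\<Sum>i\<in>{i \<in> {1..n}. orbit \<sigma> i = c}. 1 / real (card (orbit \<sigma> i))) =
       (\<Sum>i\<in>{i \<in> {1..n}. orbit \<sigma> i = c}. 1 / real (card c))"
      by (rule sum.cong) auto
    ultimately show ?thesis by simp
  qed
  then have "(\<Sum>c\<in>orbit \<sigma> ` {1..n}. 1) = (\<Sum>c\<in>orbit \<sigma> ` {1..n}. \<Sum>i\<in>{i \<in> {1..n}. orbit \<sigma> i = c}. 1 / real (card (orbit \<sigma> i)))"
    by (intro sum.cong) auto
  also have "\<dots> = (\<Sum>i = 1..n. 1 / real (card (orbit \<sigma> i)))"
    by (rule sum.group) auto
  finally show ?thesis unfolding num_cycles_def Setcompr_eq_image by simp
qed

lemma expectation_num_cycles:
  "En \<theta> n (\<lambda>\<sigma>. real (num_cycles n \<sigma>)) = real n * (\<Sum>l = 1..n. len_prob \<theta> n l / real l)"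
proof -
  have "En \<theta> n (\<lambda>\<sigma>. real (num_cycles n \<sigma>)) =
     (\<Sum>\<sigma>\<in>perms n. \<Sum>i = 1..n. 1 / real (card (orbit \<sigma> i)) * weight \<theta> n \<sigma> / (fact n * h_n \<theta> n))"
    unfolding En_def by (intro sum.cong) (auto simp: perms_def num_cycles_eq sum_distrib_right sum_divide_distrib)
  also have "\<dots> = (\<Sum>i = 1..n. En \<theta> n (\<lambda>\<sigma>. 1 / real (card (orbit \<sigma> i))))"
    unfolding En_def by (rule sum.swap)
  also have "\<dots> = (\<Sum>i = 1..n. \<Sum>l = 1..n. 1 / real l * len_prob \<theta> n l)"
    by (intro sum.cong refl expectation_orbit_card)
  finally show ?thesis by simp
qed

lemma prob_cyc_counts:
  "Pn \<theta> n {\<sigma>. \<forall>j\<in>{1..m}. cyc_count n \<sigma> j = k j} = parts_seq \<theta> m k n / hseq \<theta> n"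
proof -
  have fin: "finite (perms n)" unfolding perms_def by (rule finite_permutations) simp
  have "(\<Sum>\<sigma>\<in>perms n \<inter> {\<sigma>. \<forall>j\<in>{1..m}. cyc_count n \<sigma> j = k j}. weight \<theta> n \<sigma>)
     = (\<Sum>\<sigma> | \<sigma> permutes {1..n}. if \<forall>j\<in>{1..m}. count (cyc_lens {1..n} \<sigma>) j = k j
            then prod_mset (image_mset \<theta> (cyc_lens {1..n} \<sigma>)) else 0)"
    using fin by (intro sum.mono_neutral_cong_left) (auto simp: perms_def weight_eq cyc_count_eq)
  also have "\<dots> = fact n * parts_seq \<theta> m k n"
    by (subst sum_permutes_parts) auto
  finally show ?thesis by (simp add: Pn_def h_n_eq flip: sum_divide_distrib)
qed

section \<open>Sequences defined by the recursion\<close>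

lemma hseq_eqI:
  assumes "f 0 = 1" "\<And>n. n > 0 \<Longrightarrow> real n * f n = (\<Sum>j = 1..n. x j * f (n - j))"
  shows "hseq x n = f n"
proof (induction n rule: less_induct)
  case (less n)
  show ?case
  proof (cases "n = 0")
    case False
    have "real n * hseq x n = real n * f n"
      unfolding hseq_rec assms(2)[of n, OF False[unfolded neq0_conv]]
      using less by (intro sum.cong) auto
    then show ?thesis using False by simp
  qed (simp add: assms)
qed

lemma hseq_cong: "(\<And>j. j \<ge> 1 \<Longrightarrow> x j = y j) \<Longrightarrow> hseq x = hseq y"
  by (rule ext, rule hseq_eqI) (simp_all add: hseq_rec)

text \<open>The Taylor coefficients of \<open>exp (c / j * z ^ j)\<close>.\<close>

definition exp_monom_coeff :: "real \<Rightarrow> nat \<Rightarrow> nat \<Rightarrow> real" where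
  "exp_monom_coeff c j i = (if j dvd i then (c / real j) ^ (i div j) / fact (i div j) else 0)"

lemma exp_monom_coeff_rec:
  assumes "j > 0"
  shows "real i * exp_monom_coeff c j i = c * (if i < j then 0 else exp_monom_coeff c j (i - j))"
proof (cases "j dvd i")
  case True
  then obtain q where q: "i = j * q" by auto
  show ?thesis
  proof (cases q)
    case (Suc p)
    have "i - j = j * p" using Suc q by simp
    then show ?thesis using Suc q assms
      by (simp add: exp_monom_coeff_def divide_simps del: of_nat_Suc) (simp add: algebra_simps)
  qed (use q assms in \<open>simp\<close>)
next
  case False
  then show ?thesis by (auto simp: exp_monom_coeff_def dvd_minus_self)
qed

lemma exp_monom_coeff_sums:
  assumes "j > 0"
  shows "exp_monom_coeff c j sums exp (c / real j)"
proof -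
  have "strict_mono (\<lambda>k. j * k)" using assms by (auto intro: strict_monoI)
  moreover have "exp_monom_coeff c j i = 0" if "i \<notin> range (\<lambda>k. j * k)" for i
    using that by (auto simp: exp_monom_coeff_def)
  moreover have "(\<lambda>k. exp_monom_coeff c j (j * k)) sums exp (c / real j)"
    using exp_converges[of "c / real j"] assms by (simp add: exp_monom_coeff_def divide_inverse mult.commute)
  ultimately show ?thesis using sums_mono_reindex by blast
qed

lemma abs_exp_monom_coeff: "\<bar>exp_monom_coeff c j i\<bar> = exp_monom_coeff \<bar>c\<bar> j i"
  by (simp add: exp_monom_coeff_def power_abs)

text \<open>Adding \<open>c\<close> to \<open>x j\<close> multiplies the generating function by
  \<open>exp (c / j * z ^ j)\<close>. The product \<open>E * A\<close> is identified by its
  logarithmic derivative: \<open>fps_XD\<close> acts on it as multiplication by the series of the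
  updated sequence.\<close>

lemma hseq_update:
  assumes "j > 0"
  shows "hseq (x(j := x j + c)) n = (\<Sum>i\<le>n. exp_monom_coeff c j i * hseq x (n - i))"
proof -
  define X where "X = Abs_fps (\<lambda>n. if n = 0 then 0 else x n)"
  define A where "A = Abs_fps (hseq x)"
  define E where "E = Abs_fps (exp_monom_coeff c j)"
  have A: "fps_XD A = X * A"
    by (rule fps_ext) (simp add: A_def X_def hseq_rec fps_mult_nth sum.atLeast_Suc_atMost)
  have E: "fps_XD E = fps_const c * (fps_X ^ j * E)"
    by (rule fps_ext) (simp add: E_def exp_monom_coeff_rec[OF assms] fps_X_power_mult_nth)
  have "fps_XD (E * A) = (X + fps_const c * fps_X ^ j) * (E * A)"
    using A E by (simp add: fps_XD_def algebra_simps)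
  moreover have "X + fps_const c * fps_X ^ j = Abs_fps (\<lambda>n. if n = 0 then 0 else (x(j := x j + c)) n)"
    using assms by (intro fps_ext) (auto simp: X_def)
  ultimately have EA: "fps_XD (E * A) = Abs_fps (\<lambda>n. if n = 0 then 0 else (x(j := x j + c)) n) * (E * A)"
    by simp
  have "hseq (x(j := x j + c)) n = fps_nth (E * A) n"
  proof (rule hseq_eqI)
    show "fps_nth (E * A) 0 = 1" by (simp add: A_def E_def exp_monom_coeff_def)
    fix n :: nat assume "n > 0"
    have "real n * fps_nth (E * A) n = fps_nth (fps_XD (E * A)) n" by simp
    also have "\<dots> = (\<Sum>i=0..n. (if i = 0 then 0 else (x(j := x j + c)) i) * fps_nth (E * A) (n - i))"
      unfolding EA by (simp add: fps_mult_nth)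
    also have "\<dots> = (\<Sum>i=1..n. (x(j := x j + c)) i * fps_nth (E * A) (n - i))"
      by (simp add: sum.atLeast_Suc_atMost del: fun_upd_apply)
    finally show "real n * fps_nth (E * A) n = (\<Sum>i=1..n. (x(j := x j + c)) i * fps_nth (E * A) (n - i))" .
  qed
  then show ?thesis by (simp add: fps_mult_nth A_def E_def atMost_atLeast0)
qed

lemma hseq_Suc_rec: "real (Suc n) * hseq x (Suc n) = (\<Sum>j\<le>n. x (Suc j) * hseq x (n - j))"
  unfolding hseq_rec[of "Suc n"] by (simp add: sum.atLeast_Suc_atMost_Suc_shift atMost_atLeast0 del: sum.cl_ivl_Suc)

text \<open>The term j = 0 adds one copy of \<open>hseq x n\<close> on both sides. The sum then has
  the range of \<open>hseq_Suc_rec\<close>, with \<open>x j\<close> in place of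
  \<open>x (Suc j)\<close>, so consecutive values of \<open>hseq\<close> can be compared term by
  term.\<close>

lemma hseq_rec0:
  assumes "x 0 = 1"
  shows "real (Suc n) * hseq x n = (\<Sum>j\<le>n. x j * hseq x (n - j))"
  using hseq_rec[of n x] assms
  by (simp add: atMost_atLeast0 sum.atLeast_Suc_atMost[of 0 n] algebra_simps)

lemma hseq_incseq:
  assumes "x 0 = 1" "incseq x" "\<And>j. x j > 0"
  shows "incseq (hseq x)"
proof (rule incseq_SucI)
  fix n
  have "real (Suc n) * hseq x n \<le> real (Suc n) * hseq x (Suc n)"
    unfolding hseq_rec0[where x=x, OF assms(1)] hseq_Suc_rec
    using hseq_pos[of x] assms incseq_SucD[OF assms(2)]
    by (intro sum_mono mult_right_mono) (auto intro: less_imp_le)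
  then show "hseq x n \<le> hseq x (Suc n)" by (simp del: of_nat_Suc)
qed

text \<open>
  Bender and Canfield's theorem. \<open>hseq\<close> ignores \<open>x 0\<close>; with \<open>x 0 = 1\<close> also \<open>(n + 1) * hseq x n\<close> is a
  convolution of \<open>x\<close> and \<open>hseq x\<close>, and antisymmetrising the resulting double sum for
  \<open>(hseq x n)\<^sup>2 - hseq x (n - 1) * hseq x (n + 1)\<close> leaves products of two factors of equal sign.
\<close>

lemma hseq_log_concave:
  assumes x0: "x 0 = 1" and pos: "\<And>j. x j > 0" and dec: "decseq (\<lambda>j. x (Suc j) / x j)"
  shows "decseq (\<lambda>n. hseq x (Suc n) / hseq x n)"
proof -
  let ?h = "hseq x"
  have hp: "?h n > 0" for n using hseq_pos pos by blast
  define \<rho> where "\<rho> = (\<lambda>n. ?h (Suc n) / ?h n)"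
  have xx: "x i * x (Suc j) \<le> x j * x (Suc i)" if "i \<le> j" for i j
    using decseqD[OF dec that] pos[of i] pos[of j] by (simp add: field_simps)
  have "\<rho> (Suc n) \<le> \<rho> n" for n
  proof (induction n rule: less_induct)
    case (less n)
    let ?N = "Suc n"
    \<comment> \<open>The shift sets the value of \<open>?h\<close> at index -1 to 0, so all four
      convolutions below can run over the same range \<open>..?N\<close>.\<close>
    define g where "g m = (if m = 0 then 0 else ?h (m - 1))" for m
    have gSuc: "g (Suc m) = ?h m" and g0: "g 0 = 0" for m by (simp_all add: g_def)
    have g_nonneg: "g m \<ge> 0" for m using hp by (simp add: g_def less_imp_le)
    have \<rho>_mono: "\<rho> b \<le> \<rho> a" if "a \<le> b" "b \<le> n" for a b
      using that
    proof (induction b rule: dec_induct)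
      case (step m)
      then show ?case using less.IH[of m] by fastforce
    qed simp
    \<comment> \<open>Log-concavity of \<open>?h\<close> up to \<open>n\<close> only, which the
      induction provides; at \<open>j = ?N\<close> the factor \<open>g 0 = 0\<close> settles the
      inequality.\<close>
    have gg: "g (Suc ?N - i) * g (?N - j) \<le> g (Suc ?N - j) * g (?N - i)" if ij: "i \<le> j" "j \<le> ?N" for i j
    proof (cases "j = ?N")
      case True
      then show ?thesis using g_nonneg by (simp add: g0)
    next
      case False
      then have j: "j \<le> n" and i: "i \<le> n" using ij by auto
      have "\<rho> (n - i) \<le> \<rho> (n - j)" using ij by (intro \<rho>_mono) auto
      then have "?h (Suc n - i) * ?h (n - j) \<le> ?h (Suc n - j) * ?h (n - i)"
        using hp[of "n - i"] hp[of "n - j"] i j by (simp add: \<rho>_def field_simps Suc_diff_le)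
      then show ?thesis using i j ij by (simp add: Suc_diff_le gSuc)
    qed
    \<comment> \<open>A difference of two products of convolutions; \<open>s1\<close> to
      \<open>s4\<close> evaluate it as (N+1) N (h(N)^2 - h(N+1) h(N-1)) with N =
      \<open>?N\<close>.\<close>
    define D where "D = (\<Sum>j\<le>?N. \<Sum>i\<le>?N. (x j * x (Suc i) - x i * x (Suc j)) * (g (Suc ?N - j) * g (?N - i)))"
    have "D = (\<Sum>j\<le>?N. \<Sum>i\<le>?N. (x i * x (Suc j) - x j * x (Suc i)) * (g (Suc ?N - i) * g (?N - j)))"
      unfolding D_def by (rule sum.swap)
    then have "2 * D = (\<Sum>j\<le>?N. \<Sum>i\<le>?N. (x j * x (Suc i) - x i * x (Suc j)) *
         (g (Suc ?N - j) * g (?N - i) - g (Suc ?N - i) * g (?N - j)))"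
      unfolding mult_2 by (subst (1) D_def) (simp add: sum.distrib[symmetric] algebra_simps)
    also have "\<dots> \<ge> 0"
    proof (intro sum_nonneg)
      fix i j assume "j \<in> {..?N}" "i \<in> {..?N}"
      then show "(x j * x (Suc i) - x i * x (Suc j)) *
         (g (Suc ?N - j) * g (?N - i) - g (Suc ?N - i) * g (?N - j)) \<ge> 0"
        using xx[of i j] gg[of i j] xx[of j i] gg[of j i]
        by (cases "i \<le> j") (auto intro: mult_nonneg_nonneg mult_nonpos_nonpos)
    qed
    finally have D: "D \<ge> 0" by simp
    have s1: "(\<Sum>j\<le>?N. x j * g (Suc ?N - j)) = real (Suc ?N) * ?h ?N"
      unfolding hseq_rec0[where x=x, OF x0] by (intro sum.cong) (auto simp: Suc_diff_le gSuc)
    have s2: "(\<Sum>j\<le>?N. x (Suc j) * g (Suc ?N - j)) = real (Suc ?N) * ?h (Suc ?N)"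
      unfolding hseq_Suc_rec by (intro sum.cong) (auto simp: Suc_diff_le gSuc)
    have s3: "(\<Sum>i\<le>?N. x i * g (?N - i)) = real ?N * ?h n"
      unfolding hseq_rec0[where x=x, OF x0] by (simp add: g0) (intro sum.cong, auto simp: Suc_diff_le gSuc)
    have s4: "(\<Sum>i\<le>?N. x (Suc i) * g (?N - i)) = real ?N * ?h ?N"
      unfolding hseq_Suc_rec by (simp add: g0) (intro sum.cong, auto simp: Suc_diff_le gSuc)
    have "D = (\<Sum>j\<le>?N. x j * g (Suc ?N - j)) * (\<Sum>i\<le>?N. x (Suc i) * g (?N - i))
        - (\<Sum>j\<le>?N. x (Suc j) * g (Suc ?N - j)) * (\<Sum>i\<le>?N. x i * g (?N - i))"
      unfolding D_def sum_product sum_subtractf[symmetric]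
      by (intro sum.cong refl) (simp add: algebra_simps)
    then have "real (Suc ?N) * real ?N * (?h ?N * ?h ?N - ?h (Suc ?N) * ?h n) \<ge> 0"
      using D unfolding s1 s2 s3 s4 by (simp add: algebra_simps)
    then have "?h (Suc ?N) * ?h n \<le> ?h ?N * ?h ?N"
      using mult_pos_pos[of "real (Suc ?N)" "real ?N"] unfolding zero_le_mult_iff by linarith
    then show "\<rho> (Suc n) \<le> \<rho> n"
      using hp[of n] hp[of ?N] by (simp add: \<rho>_def field_simps)
  qed
  then show ?thesis unfolding \<rho>_def by (rule decseq_SucI)
qed

text \<open>One index is changed at a time. Each change convolves with the coefficients of an entire
  function, and since \<open>hseq x (n - i) / hseq x n\<close> tends to 1 the limit is multiplied by
  the value of that function at 1. Monotonicity keeps these quotients at most 1 and so gives the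
  summable majorant for Tannery's theorem.\<close>

lemma hseq_perturb:
  assumes "\<And>n. hseq x n > 0" "incseq (hseq x)"
    and ratio: "\<And>i. (\<lambda>n. hseq x (n - i) / hseq x n) \<longlonglongrightarrow> 1"
    and "\<And>j. j > M \<Longrightarrow> y j = x j"
  shows "(\<lambda>n. hseq y n / hseq x n) \<longlonglongrightarrow> exp (\<Sum>j = 1..M. (y j - x j) / real j)"
  using assms(4)
proof (induction M arbitrary: y)
  case 0
  have "hseq y = hseq x" by (rule hseq_cong) (use 0 in auto)
  then show ?case using assms(1) by (simp add: less_imp_neq[THEN not_sym])
next
  case (Suc M)
  let ?b = "hseq x"
  \<comment> \<open>\<open>y'\<close> already agrees with \<open>x\<close> beyond \<open>M\<close>,
    so the induction hypothesis covers it; \<open>y\<close> differs from \<open>y'\<close> only at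
    \<open>Suc M\<close>, by \<open>c\<close>.\<close>
  define y' where "y' = y(Suc M := x (Suc M))"
  define c where "c = y (Suc M) - x (Suc M)"
  let ?e = "exp_monom_coeff c (Suc M)"
  define \<beta> where "\<beta> = exp (\<Sum>j = 1..M. (y' j - x j) / real j)"
  have y: "y = y'(Suc M := y' (Suc M) + c)" by (auto simp: y'_def c_def)
  have lim': "(\<lambda>n. hseq y' n / ?b n) \<longlonglongrightarrow> \<beta>"
    unfolding \<beta>_def by (rule Suc.IH) (use Suc.prems in \<open>auto simp: y'_def\<close>)
  then obtain K where K: "\<And>n. \<bar>hseq y' n / ?b n\<bar> \<le> K"
    using convergent_imp_Bseq[OF convergentI[OF lim']] unfolding Bseq_def by auto
  \<comment> \<open>The convolution padded with zeros for i > n, so that it becomes a series over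
    all i.\<close>
  define a where "a i n = (if i \<le> n then ?e i * hseq y' (n - i) / ?b n else 0)" for i n
  have quot: "hseq y' (n - i) / ?b n = hseq y' (n - i) / ?b (n - i) * (?b (n - i) / ?b n)" for i n
    using assms(1)[of "n - i"] by simp
  have a_lim: "(\<lambda>n. a i n) \<longlonglongrightarrow> ?e i * \<beta>" for i
  proof -
    have "(\<lambda>n. hseq y' (n - i) / ?b (n - i)) \<longlonglongrightarrow> \<beta>"
      by (rule filterlim_compose[OF lim' filterlim_minus_const_nat_at_top])
    from tendsto_mult[OF this ratio[of i]] have "(\<lambda>n. hseq y' (n - i) / ?b n) \<longlonglongrightarrow> \<beta>"
      unfolding quot[symmetric] by simp
    from tendsto_mult_left[OF this, of "?e i"]
    have "(\<lambda>n. ?e i * (hseq y' (n - i) / ?b n)) \<longlonglongrightarrow> ?e i * \<beta>" .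
    moreover have "eventually (\<lambda>n. ?e i * (hseq y' (n - i) / ?b n) = a i n) sequentially"
      using eventually_ge_at_top[of i] by eventually_elim (simp add: a_def)
    ultimately show ?thesis by (rule Lim_transform_eventually)
  qed
  have a_bound: "norm (a i n) \<le> exp_monom_coeff \<bar>c\<bar> (Suc M) i * K" for i n
  proof -
    have K0: "K \<ge> 0" using K[of 0] by linarith
    have e0: "exp_monom_coeff \<bar>c\<bar> (Suc M) i \<ge> 0" by (simp add: exp_monom_coeff_def)
    have "\<bar>hseq y' (n - i) / ?b n\<bar> \<le> K * 1"
      unfolding quot abs_mult
    proof (intro mult_mono K K0)
      show "\<bar>?b (n - i) / ?b n\<bar> \<le> 1"
        using assms(1)[of n] assms(1)[of "n - i"] incseqD[OF assms(2), of "n - i" n] by simp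
    qed simp
    then have "\<bar>?e i\<bar> * \<bar>hseq y' (n - i) / ?b n\<bar> \<le> exp_monom_coeff \<bar>c\<bar> (Suc M) i * K"
      unfolding abs_exp_monom_coeff using e0 by (intro mult_left_mono) auto
    then show ?thesis using e0 K0 by (simp add: a_def abs_mult)
  qed
  have "(\<lambda>n. \<Sum>i. a i n) \<longlonglongrightarrow> (\<Sum>i. ?e i * \<beta>)"
  proof (rule tannerys_theorem[THEN conjunct2, THEN conjunct2])
    show "\<And>i. (\<lambda>n. a i n) \<longlonglongrightarrow> ?e i * \<beta>" by (rule a_lim)
    show "\<forall>\<^sub>F (i, n) in sequentially \<times>\<^sub>F sequentially. norm (a i n) \<le> exp_monom_coeff \<bar>c\<bar> (Suc M) i * K"
      using a_bound by (intro always_eventually) auto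
    show "summable (\<lambda>i. exp_monom_coeff \<bar>c\<bar> (Suc M) i * K)"
      using exp_monom_coeff_sums[of "Suc M" "\<bar>c\<bar>"] by (intro summable_mult2) (simp add: sums_iff)
  qed simp
  moreover have "(\<Sum>i. a i n) = hseq y n / ?b n" for n
  proof -
    have "(\<Sum>i. a i n) = (\<Sum>i\<le>n. a i n)" by (rule suminf_finite) (auto simp: a_def)
    also have "\<dots> = hseq y n / ?b n"
      by (subst y, subst hseq_update) (simp_all add: a_def sum_divide_distrib)
    finally show ?thesis .
  qed
  moreover have "(\<Sum>i. ?e i * \<beta>) = exp (\<Sum>j = 1..Suc M. (y j - x j) / real j)"
  proof -
    have "(\<Sum>i. ?e i * \<beta>) = exp (c / real (Suc M)) * \<beta>"
      using sums_mult2[OF exp_monom_coeff_sums[of "Suc M" c], of \<beta>] by (simp add: sums_iff)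
    moreover have "\<beta> = exp (\<Sum>j = 1..M. (y j - x j) / real j)"
      unfolding \<beta>_def y'_def by (intro arg_cong[where f = exp] sum.cong) auto
    ultimately show ?thesis by (simp add: exp_add[symmetric] c_def add.commute)
  qed
  ultimately show ?case by simp
qed

section \<open>Log-concavity and the quotient bound\<close>

text \<open>Index 0 is included, with value \<open>Gamma (\<gamma> + 1)\<close>: this completes the
  weights to the binomial series in \<open>gam_coeff_sums\<close>.\<close>

definition gam_coeff :: "real \<Rightarrow> nat \<Rightarrow> real" where
  "gam_coeff \<gamma> n = Gamma (real n + \<gamma> + 1) / fact n"

lemma gam_coeff_pos: "\<gamma> > 0 \<Longrightarrow> gam_coeff \<gamma> n > 0"
  by (simp add: gam_coeff_def Gamma_real_pos)

lemma gam_coeff_Suc: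
  assumes "\<gamma> > 0"
  shows "gam_coeff \<gamma> (Suc n) = gam_coeff \<gamma> n * (1 + \<gamma> / real (Suc n))"
proof -
  have "real n + \<gamma> + 1 \<notin> \<int>\<^sub>\<le>\<^sub>0" using assms by (auto elim!: nonpos_Ints_cases)
  then have "Gamma (real (Suc n) + \<gamma> + 1) = (real n + \<gamma> + 1) * Gamma (real n + \<gamma> + 1)"
    using Gamma_plus1[of "real n + \<gamma> + 1"] by (simp add: add_ac)
  then show ?thesis by (simp add: gam_coeff_def divide_simps del: of_nat_Suc)
qed

lemma gam_coeff_pochhammer:
  assumes "\<gamma> > 0"
  shows "gam_coeff \<gamma> n = Gamma (\<gamma> + 1) * pochhammer (\<gamma> + 1) n / fact n"
proof -
  have "\<gamma> + 1 \<notin> \<int>\<^sub>\<le>\<^sub>0" using assms by (auto elim!: nonpos_Ints_cases)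
  moreover from this have "Gamma (\<gamma> + 1) \<noteq> 0" by (simp add: Gamma_eq_zero_iff)
  ultimately show ?thesis by (simp add: gam_coeff_def pochhammer_Gamma add_ac)
qed

text \<open>Euler's limit formula for \<open>Gamma (\<gamma> + 1)\<close> in the form
  \<open>Gamma_series'\<close>, inverted.\<close>

lemma gam_coeff_asymp:
  assumes "\<gamma> > 0"
  shows "(\<lambda>n. gam_coeff \<gamma> n / real n powr \<gamma>) \<longlonglongrightarrow> 1"
proof -
  have G: "Gamma (\<gamma> + 1) > 0" using assms by (simp add: Gamma_real_pos)
  have "(\<lambda>n. Gamma (\<gamma> + 1) / Gamma_series' (\<gamma> + 1) n) \<longlonglongrightarrow> Gamma (\<gamma> + 1) / Gamma (\<gamma> + 1)"
    using G by (intro tendsto_divide tendsto_const Gamma_series'_LIMSEQ) auto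
  moreover have "eventually (\<lambda>n. Gamma (\<gamma> + 1) / Gamma_series' (\<gamma> + 1) n = gam_coeff \<gamma> n / real n powr \<gamma>) sequentially"
    using eventually_gt_at_top[of 0]
  proof eventually_elim
    case (elim n)
    have "exp ((\<gamma> + 1) * ln (real n)) = real n * real n powr \<gamma>"
      using elim by (simp add: powr_def algebra_simps exp_add)
    moreover have "fact n = real n * fact (n - 1)" using elim by (rule fact_reduce)
    ultimately show ?case
      using elim by (simp add: Gamma_series'_def gam_coeff_pochhammer[OF assms])
  qed
  ultimately show ?thesis using G by (auto dest: Lim_transform_eventually)
qed

lemma gam_coeff_at_top:
  assumes "\<gamma> > 0"
  shows "filterlim (gam_coeff \<gamma>) at_top sequentially"
proof -
  have "filterlim (\<lambda>n. gam_coeff \<gamma> n / real n powr \<gamma> * real n powr \<gamma>) at_top sequentially"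
  proof (rule filterlim_tendsto_pos_mult_at_top[OF gam_coeff_asymp[OF assms]])
    show "filterlim (\<lambda>n. real n powr \<gamma>) at_top sequentially"
      using assms by real_asymp
  qed simp
  moreover have "eventually (\<lambda>n. gam_coeff \<gamma> n / real n powr \<gamma> * real n powr \<gamma> = gam_coeff \<gamma> n) sequentially"
    using eventually_gt_at_top[of 0] by eventually_elim simp
  ultimately show ?thesis using filterlim_cong[OF refl refl] by fast
qed

lemma gam_coeff_sums:
  assumes "\<gamma> > 0" "0 \<le> r" "r < 1"
  shows "(\<lambda>n. gam_coeff \<gamma> n * r ^ n) sums (Gamma (\<gamma> + 1) * (1 - r) powr (- (\<gamma> + 1)))"
proof -
  have "(\<lambda>n. ((- (\<gamma> + 1)) gchoose n) * (- r) ^ n) sums (1 + (- r)) powr (- (\<gamma> + 1))"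
    using assms by (intro gen_binomial_real) auto
  then have "(\<lambda>n. Gamma (\<gamma> + 1) * (((- (\<gamma> + 1)) gchoose n) * (- r) ^ n)) sums (Gamma (\<gamma> + 1) * (1 + (- r)) powr (- (\<gamma> + 1)))"
    by (rule sums_mult)
  moreover have "Gamma (\<gamma> + 1) * (((- (\<gamma> + 1)) gchoose n) * (- r) ^ n) = gam_coeff \<gamma> n * r ^ n" for n
  proof -
    have "(- r) ^ n = (- 1) ^ n * r ^ n" by (rule power_minus)
    moreover have "(- 1 :: real) ^ n * (- 1) ^ n = 1" by (simp flip: power_mult_distrib)
    ultimately show ?thesis
      by (simp add: gbinomial_pochhammer gam_coeff_pochhammer[OF assms(1)] add.commute)
  qed
  ultimately show ?thesis by simp
qed

text \<open>\<open>1, gam_coeff \<gamma> 1, gam_coeff \<gamma> 2, \<dots>\<close> is not log-concave at the start for small \<open>\<gamma>\<close>, so an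
  initial segment is replaced by the geometric progression from \<open>1\<close> to \<open>gam_coeff \<gamma> J\<close>.\<close>

lemma log_concave_modification:
  assumes "\<gamma> > 0"
  obtains x J where "x 0 = 1" "\<And>j. x j > 0" "incseq x" "decseq (\<lambda>j. x (Suc j) / x j)"
    "\<And>j. j \<ge> J \<Longrightarrow> x j = gam_coeff \<gamma> j"
proof -
  note pos = gam_coeff_pos[OF assms]
  \<comment> \<open>At the junction the common ratio \<open>\<tau>\<close> must be at least the next
    quotient \<open>1 + \<gamma> / (J + 1)\<close>. The J-th power of the latter is at most
    \<open>exp \<gamma>\<close>, while \<open>\<tau> ^ J = gam_coeff \<gamma> J\<close>, hence this
    choice of \<open>J\<close>.\<close>
  have "eventually (\<lambda>J. gam_coeff \<gamma> J \<ge> exp \<gamma> \<and> J \<ge> 1) sequentially"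
    using gam_coeff_at_top[OF assms] unfolding filterlim_at_top
    by (intro eventually_conj eventually_ge_at_top) auto
  then obtain J where J: "gam_coeff \<gamma> J \<ge> exp \<gamma>" "J \<ge> 1"
    by (auto simp: eventually_sequentially)
  define \<tau> where "\<tau> = root J (gam_coeff \<gamma> J)"
  have \<tau>: "\<tau> > 0" "\<tau> ^ J = gam_coeff \<gamma> J"
    using J pos[of J] by (auto simp: \<tau>_def)
  define x where "x j = (if j < J then \<tau> ^ j else gam_coeff \<gamma> j)" for j
  have ratio1: "x (Suc j) = x j * \<tau>" if "j < J" for j
  proof (cases "Suc j < J")
    case False
    then have "Suc j = J" using that by simp
    then show ?thesis using \<tau>(2) that by (auto simp: x_def power_Suc2[symmetric])
  qed (use that in \<open>simp add: x_def\<close>)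
  have ratio2: "x (Suc j) = x j * (1 + \<gamma> / real (Suc j))" if "j \<ge> J" for j
    using that gam_coeff_Suc[OF assms] by (simp add: x_def)
  have xpos: "x j > 0" for j using \<tau> pos by (simp add: x_def)
  have \<tau>_ge: "1 + \<gamma> / real (Suc J) \<le> \<tau>"
  proof -
    have "(1 + \<gamma> / real (Suc J)) ^ J \<le> exp (\<gamma> / real (Suc J)) ^ J"
      using assms by (intro power_mono) auto
    also have "\<dots> = exp (real J * (\<gamma> / real (Suc J)))" by (simp only: exp_of_nat_mult)
    also have "\<dots> \<le> exp \<gamma>" using assms by (simp add: field_simps)
    also have "\<dots> \<le> \<tau> ^ J" using J \<tau> by simp
    finally show ?thesis
      using power_mono_iff[of "1 + \<gamma> / real (Suc J)" \<tau> J] \<tau> J assms by simp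
  qed
  have \<tau>1: "\<tau> \<ge> 1"
  proof -
    have "\<gamma> / real (Suc J) > 0" using assms by simp
    then show ?thesis using \<tau>_ge by linarith
  qed
  have q: "x (Suc j) / x j = (if j < J then \<tau> else 1 + \<gamma> / real (Suc j))" for j
    using ratio1[of j] ratio2[of j] xpos[of j] by auto
  show ?thesis
  proof (rule that[of x J])
    show "x 0 = 1" using J by (simp add: x_def)
    show "x j > 0" for j by (rule xpos)
    show "x j = gam_coeff \<gamma> j" if "j \<ge> J" for j using that by (simp add: x_def)
    show "incseq x"
    proof (rule incseq_SucI)
      fix j
      have "x (Suc j) / x j \<ge> 1" unfolding q using \<tau>1 assms by auto
      then show "x j \<le> x (Suc j)" using xpos[of j] by (simp add: field_simps)
    qed
    show "decseq (\<lambda>j. x (Suc j) / x j)"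
    proof (rule decseq_SucI)
      fix j
      have "\<gamma> / real (Suc (Suc j)) \<le> \<gamma> / real (Suc j)" using assms by (intro divide_left_mono) auto
      moreover have "1 + \<gamma> / real (Suc (Suc j)) \<le> \<tau>" if "\<not> Suc j < J" "j < J"
      proof -
        have "J = Suc j" using that by simp
        then show ?thesis using \<tau>_ge by simp
      qed
      ultimately show "x (Suc (Suc j)) / x (Suc j) \<le> x (Suc j) / x j"
        unfolding q by auto
    qed
  qed
qed

locale log_concave_coeffs =
  fixes \<gamma> :: real and x :: "nat \<Rightarrow> real" and J :: nat
  assumes \<gamma>: "\<gamma> > 0" and x0: "x 0 = 1" and xpos: "\<And>j. x j > 0" and xinc: "incseq x"
    and xdec: "decseq (\<lambda>j. x (Suc j) / x j)" and xJ: "\<And>j. j \<ge> J \<Longrightarrow> x j = gam_coeff \<gamma> j"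
begin

definition a where "a = Gamma (\<gamma> + 1) powr (1 / (\<gamma> + 1))"
text \<open>Bounds what the modified initial segment contributes to the sum of
  \<open>x j * r ^ j\<close>, uniformly for r in [0, 1].\<close>

definition C where "C = (\<Sum>j<J. x j)"
abbreviation "b \<equiv> hseq x"
abbreviation "\<delta> \<equiv> 1 / (\<gamma> + 1)"

lemma b_pos: "b n > 0"
  using hseq_pos[of x] xpos by blast

lemma b_inc: "incseq b"
  using x0 xinc xpos by (rule hseq_incseq)

lemma a_pos: "a > 0"
  using \<gamma> by (simp add: a_def Gamma_real_pos less_imp_neq[THEN not_sym])

lemma b_ratio_antimono:
  assumes "1 \<le> m" "m \<le> n"
  shows "b (m - 1) / b m \<le> b (n - 1) / b n"
proof -
  have "b (Suc (n - 1)) / b (n - 1) \<le> b (Suc (m - 1)) / b (m - 1)"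
    by (rule decseqD[OF hseq_log_concave[OF x0 xpos xdec]]) (use assms in auto)
  then have "b n / b (n - 1) \<le> b m / b (m - 1)" using assms by simp
  then show ?thesis using b_pos[of n] b_pos[of m] b_pos[of "n-1"] b_pos[of "m-1"]
    by (simp add: field_simps)
qed

lemma b_minus_le:
  assumes "j \<le> n"
  shows "b (n - j) \<le> (b (n - 1) / b n) ^ j * b n"
  using assms
proof (induction j)
  case (Suc j)
  let ?r = "b (n - 1) / b n"
  have r: "?r \<ge> 0" using b_pos by (simp add: less_imp_le)
  have "b (n - Suc j) = b (n - j - 1) / b (n - j) * b (n - j)"
    using b_pos[of "n - j"] by simp
  also have "\<dots> \<le> ?r * b (n - j)"
    using Suc.prems b_pos[of "n - j"] by (intro mult_right_mono b_ratio_antimono) (auto intro: less_imp_le)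
  also have "\<dots> \<le> ?r * (?r ^ j * b n)"
    using Suc r by (intro mult_left_mono) auto
  finally show ?case by simp
qed simp

text \<open>Substituting \<open>b_minus_le\<close> into the recursion bounds \<open>n\<close> by the
  sum of \<open>x j * r ^ j\<close>. The first \<open>J\<close> terms cost at most \<open>C\<close>,
  and the others are dominated by the full binomial series, whose closed form can be solved for 1 -
  r.\<close>

lemma b_ratio_bound:
  assumes n: "real n > C" "n \<ge> 1"
  shows "1 - b (n - 1) / b n \<le> a * (real n - C) powr (- \<delta>)"
proof -
  define r where "r = b (n - 1) / b n"
  have r0: "r \<ge> 0" using b_pos by (simp add: r_def less_imp_le)
  have r1: "r \<le> 1" using b_pos[of n] incseqD[OF b_inc, of "n-1" n] by (simp add: r_def)
  show ?thesis
  proof (cases "r = 1")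
    case True
    then show ?thesis using a_pos by (simp add: r_def)
  next
    case False
    then have r: "r < 1" using r1 by simp
    let ?G = "Gamma (\<gamma> + 1)"
    have G: "?G > 0" using \<gamma> by (simp add: Gamma_real_pos)
    note S = gam_coeff_sums[OF \<gamma> r0 r]
    have nn: "gam_coeff \<gamma> j * r ^ j \<ge> 0" for j using gam_coeff_pos[OF \<gamma>, of j] r0 by simp
    have "real n * b n = (\<Sum>j = 1..n. x j * b (n - j))" by (rule hseq_rec)
    also have "\<dots> \<le> (\<Sum>j = 1..n. x j * (r ^ j * b n))"
      using xpos b_minus_le by (intro sum_mono mult_left_mono) (auto simp: r_def intro: less_imp_le)
    also have "\<dots> = (\<Sum>j = 1..n. x j * r ^ j) * b n" by (simp add: sum_distrib_right mult.assoc)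
    finally have "real n \<le> (\<Sum>j = 1..n. x j * r ^ j)" using b_pos[of n] by simp
    also have "\<dots> \<le> (\<Sum>j = 1..n. (if j < J then x j else 0) + gam_coeff \<gamma> j * r ^ j)"
    proof (rule sum_mono)
      fix j
      have "x j * r ^ j \<le> x j * 1" using xpos[of j] r0 r1 by (intro mult_left_mono power_le_one) auto
      then show "x j * r ^ j \<le> (if j < J then x j else 0) + gam_coeff \<gamma> j * r ^ j"
        using xJ[of j] nn[of j] by auto
    qed
    also have "\<dots> = (\<Sum>j = 1..n. if j < J then x j else 0) + (\<Sum>j = 1..n. gam_coeff \<gamma> j * r ^ j)"
      by (simp add: sum.distrib)
    also have "(\<Sum>j = 1..n. if j < J then x j else 0) = (\<Sum>j\<in>{1..n} \<inter> {..<J}. x j)"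
      by (intro sum.mono_neutral_cong_right) auto
    also have "\<dots> \<le> C"
      unfolding C_def using xpos by (intro sum_mono2) (auto intro: less_imp_le)
    also have "(\<Sum>j = 1..n. gam_coeff \<gamma> j * r ^ j) \<le> ?G * (1 - r) powr (- (\<gamma> + 1))"
      unfolding sums_unique[OF S] using nn S by (intro sum_le_suminf) (auto simp: sums_iff)
    finally have *: "real n - C \<le> ?G * (1 - r) powr (- (\<gamma> + 1))" by simp
    \<comment> \<open>Raising to the power \<open>\<delta>\<close> turns
      \<open>Gamma (\<gamma> + 1)\<close> into \<open>a\<close> and the exponent of 1 - r into
      -1.\<close>
    have "(real n - C) powr \<delta> \<le> (?G * (1 - r) powr (- (\<gamma> + 1))) powr \<delta>"
      using n \<gamma> * by (intro powr_mono2) auto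
    also have "\<dots> = a * (1 - r) powr (- 1)"
    proof -
      have "- (\<gamma> + 1) * \<delta> = - 1" using \<gamma> by (simp add: field_simps)
      then show ?thesis using G r by (simp only: powr_mult a_def powr_powr)
    qed
    also have "\<dots> = a / (1 - r)" using r by (simp add: powr_minus divide_inverse)
    finally have "(1 - r) * (real n - C) powr \<delta> \<le> a" using r by (simp add: field_simps)
    moreover have "(real n - C) powr \<delta> > 0" using n by simp
    ultimately show ?thesis
      unfolding r_def[symmetric] by (simp add: powr_minus field_simps)
  qed
qed

lemma b_ratio_le_1: "b (n - i) / b n \<le> 1"
  using b_pos[of n] incseqD[OF b_inc, of "n-i" n] by simp

text \<open>The quotient telescopes into \<open>l\<close> consecutive quotients. The bound from
  \<open>b_ratio_bound\<close> gets better as the index grows, so its value at \<open>n - l\<close>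
  is valid for each of them; the last assumption makes this common factor nonnegative.\<close>

lemma b_minus_ge:
  assumes "l \<le> n" "real (n - l) > C" "a * (real (n - l) - C) powr (- \<delta>) \<le> 1"
  shows "b (n - l) / b n \<ge> (1 - a * (real (n - l) - C) powr (- \<delta>)) ^ l"
proof -
  define s where "s = 1 - a * (real (n - l) - C) powr (- \<delta>)"
  have s0: "s \<ge> 0" using assms by (simp add: s_def)
  have "b (n - l) \<ge> s ^ k * b (n - l + k)" for k
  proof (induction k)
    case (Suc k)
    let ?m = "n - l + Suc k"
    have "s \<le> 1 - a * (real ?m - C) powr (- \<delta>)"
      unfolding s_def using a_pos assms \<gamma>
      by (intro diff_left_mono mult_left_mono powr_mono2') auto
    also have "\<dots> \<le> b (?m - 1) / b ?m"
      using b_ratio_bound[of ?m] assms by simp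
    finally have "s * b ?m \<le> b (n - l + k)"
      using b_pos[of ?m] by (simp add: field_simps)
    then have "s ^ k * (s * b ?m) \<le> s ^ k * b (n - l + k)"
      using s0 by (intro mult_left_mono) auto
    then show ?case using Suc by (simp add: mult_ac)
  qed simp
  from this[of l] show ?thesis using assms(1) b_pos[of n] by (simp add: s_def field_simps)
qed

lemma b_ratio_lim: "(\<lambda>n. b (n - i) / b n) \<longlonglongrightarrow> 1"
proof (rule tendsto_sandwich[OF _ _ _ tendsto_const])
  have lim0: "(\<lambda>n. a * (real (n - i) - C) powr (- \<delta>)) \<longlonglongrightarrow> 0"
  proof (rule tendsto_mult_right_zero, rule tendsto_neg_powr)
    show "- \<delta> < 0" using \<gamma> by simp
    have "filterlim (\<lambda>n. real (n - i)) at_top sequentially"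
      by (rule filterlim_compose[OF filterlim_real_sequentially filterlim_minus_const_nat_at_top])
    from filterlim_tendsto_add_at_top[OF tendsto_const[of "- C"] this]
    show "filterlim (\<lambda>n. real (n - i) - C) at_top sequentially" by simp
  qed
  have "(\<lambda>n. (1 - a * (real (n - i) - C) powr (- \<delta>)) ^ i) \<longlonglongrightarrow> (1 - 0) ^ i"
    by (intro tendsto_power tendsto_diff tendsto_const lim0)
  then show "(\<lambda>n. (1 - a * (real (n - i) - C) powr (- \<delta>)) ^ i) \<longlonglongrightarrow> 1" by simp
  have 1: "eventually (\<lambda>n. a * (real (n - i) - C) powr (- \<delta>) < 1) sequentially"
    using lim0 by (rule order_tendstoD) simp
  have 2: "eventually (\<lambda>n. real (n - i) > C) sequentially"
    using filterlim_compose[OF filterlim_real_sequentially filterlim_minus_const_nat_at_top[of i]]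
    unfolding filterlim_at_top_dense by blast
  show "eventually (\<lambda>n. (1 - a * (real (n - i) - C) powr (- \<delta>)) ^ i \<le> b (n - i) / b n) sequentially"
    using 1 2 eventually_ge_at_top[of i]
    by eventually_elim (rule b_minus_ge, auto)
  show "eventually (\<lambda>n. b (n - i) / b n \<le> 1) sequentially"
    by (simp add: b_ratio_le_1)
qed

end

section \<open>Lower bound for the rescaled density\<close>

text \<open>Used with \<open>p = \<gamma> + 1\<close> for the mass of the limit density, and with
  \<open>p = \<gamma>\<close> for its mean of 1/u.\<close>

lemma gamma_density_integral:
  fixes p c :: real
  assumes "p > 0" "c > 0"
  shows "has_bochner_integral lborel (\<lambda>u. indicator {0..} u * (u powr (p - 1) * exp (- c * u))) (Gamma p / c powr p)"
proof -
  let ?f = "\<lambda>t. indicator {0..} t * t powr (p - 1) / exp t :: real"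
  have "has_bochner_integral lborel ?f (Gamma p)"
  proof (rule has_bochner_integral_nn_integral)
    show "(\<integral>\<^sup>+t. ennreal (?f t) \<partial>lborel) = ennreal (Gamma p)"
      using Gamma_conv_nn_integral_real[OF assms(1)] by simp
    show "Gamma p \<ge> 0" using assms by (simp add: Gamma_real_pos less_imp_le)
  qed auto
  then have "has_bochner_integral lborel (\<lambda>u. ?f (0 + c * u)) (Gamma p /\<^sub>R \<bar>c\<bar>)"
    using assms lborel_has_bochner_integral_real_affine_iff[of c ?f "Gamma p" 0] by simp
  then have "has_bochner_integral lborel (\<lambda>u. c powr (1 - p) * ?f (0 + c * u)) (c powr (1 - p) * (Gamma p /\<^sub>R \<bar>c\<bar>))"
    by (rule has_bochner_integral_mult_right)
  moreover have "c powr (1 - p) * (Gamma p /\<^sub>R \<bar>c\<bar>) = Gamma p / c powr p"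
    using assms by (simp add: powr_diff field_simps)
  moreover have "c powr (1 - p) * ?f (0 + c * u) = indicator {0..} u * (u powr (p - 1) * exp (- c * u))" for u
  proof -
    have "c powr (1 - p) * c powr (p - 1) = 1"
      using assms by (simp flip: powr_add)
    then show ?thesis using assms
      by (auto simp: indicator_def powr_mult exp_minus divide_inverse zero_le_mult_iff)
  qed
  ultimately show ?thesis by simp
qed

text \<open>The intervals are closed on the right, so u > 0 lies in exactly the one whose index is
  the ceiling of \<open>u * N\<close>.\<close>

lemma step_function_eq:
  fixes c :: "nat \<Rightarrow> real"
  assumes "N > 0" "u > 0"
  shows "(\<Sum>l = 1..n. c l * indicator {(real l - 1) / N<..real l / N} u)
     = (if nat \<lceil>u * N\<rceil> \<le> n then c (nat \<lceil>u * N\<rceil>) else 0)"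
proof -
  have pos: "\<lceil>u * N\<rceil> > 0" using assms by simp
  have ind: "indicator {(real l - 1) / N<..real l / N} u = (if l = nat \<lceil>u * N\<rceil> then 1 else 0 :: real)" for l
  proof -
    have "u \<in> {(real l - 1) / N<..real l / N} \<longleftrightarrow> \<lceil>u * N\<rceil> = int l"
      using assms by (auto simp: ceiling_eq_iff field_simps)
    also have "\<dots> \<longleftrightarrow> l = nat \<lceil>u * N\<rceil>" using pos by auto
    finally show ?thesis by (simp add: indicator_def)
  qed
  have "1 \<le> nat \<lceil>u * N\<rceil>" using pos by linarith
  then show ?thesis unfolding ind by (simp add: if_distrib[of "(*) _"] cong: if_cong)
qed

lemma step_function_nonpos:
  fixes c :: "nat \<Rightarrow> real"
  assumes "N > 0" "u \<le> 0"
  shows "(\<Sum>l = 1..n. c l * indicator {(real l - 1) / N<..real l / N} u) = 0"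
proof (rule sum.neutral, rule ballI)
  fix l assume l: "l \<in> {1..n}"
  then have "(real l - 1) / N \<ge> 0" using assms by simp
  then show "c l * indicator {(real l - 1) / N<..real l / N} u = 0"
    using assms by (simp add: indicator_def)
qed

lemma step_function_integral:
  fixes c :: "nat \<Rightarrow> real"
  assumes "N > 0"
  shows "has_bochner_integral lborel (\<lambda>u. \<Sum>l = 1..n. c l * indicator {(real l - 1) / N<..real l / N} u)
           (\<Sum>l = 1..n. c l / N)"
proof (rule has_bochner_integral_sum)
  fix l
  have "has_bochner_integral lborel (\<lambda>u. c l * indicator {(real l - 1) / N<..real l / N} u) (c l * measure lborel {(real l - 1) / N<..real l / N})"
    using assms by (intro has_bochner_integral_mult_right has_bochner_integral_real_indicator)
      (auto simp: emeasure_lborel_Ioc divide_right_mono)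
  then show "has_bochner_integral lborel (\<lambda>u. c l * indicator {(real l - 1) / N<..real l / N} u) (c l / N)"
    using assms by (simp add: measure_lborel_Ioc divide_right_mono diff_divide_distrib)
qed

text \<open>As the integrals agree, the positive and negative parts of \<open>f - F n\<close> have
  equal integrals, so the L1 distance is twice the integral of the positive part. That part is
  dominated by \<open>f\<close>, so an asymptotic lower bound for \<open>F n\<close>
  suffices.\<close>

lemma scheffe_lower:
  fixes F :: "nat \<Rightarrow> 'a \<Rightarrow> real"
  assumes F: "\<And>n. integrable M (F n)" "\<And>n u. F n u \<ge> 0" "\<And>n. integral\<^sup>L M (F n) = integral\<^sup>L M f"
    and f: "integrable M f" "\<And>u. f u \<ge> 0"
    and lim: "AE u in M. (\<lambda>n. max 0 (f u - F n u)) \<longlonglongrightarrow> 0"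
  shows "(\<lambda>n. \<integral>u. \<bar>F n u - f u\<bar> \<partial>M) \<longlonglongrightarrow> 0"
proof -
  have [measurable]: "F n \<in> borel_measurable M" "f \<in> borel_measurable M" for n
    using F f by auto
  have bnd: "norm (max 0 (f u - F n u)) \<le> f u" for n u using F(2)[of n u] f(2)[of u] by auto
  have "(\<lambda>n. \<integral>u. max 0 (f u - F n u) \<partial>M) \<longlonglongrightarrow> (\<integral>u. 0 \<partial>M)"
    by (rule integral_dominated_convergence[where w = f]) (use f lim bnd in auto)
  then have "(\<lambda>n. 2 * (\<integral>u. max 0 (f u - F n u) \<partial>M)) \<longlonglongrightarrow> 2 * 0"
    by (intro tendsto_mult tendsto_const) simp
  moreover have "(\<integral>u. \<bar>F n u - f u\<bar> \<partial>M) = 2 * (\<integral>u. max 0 (f u - F n u) \<partial>M)" for n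
  proof -
    have int: "integrable M (\<lambda>u. max 0 (f u - F n u))"
      using F f by (intro integrable_max) auto
    have "(\<integral>u. \<bar>F n u - f u\<bar> \<partial>M) = (\<integral>u. 2 * max 0 (f u - F n u) - (f u - F n u) \<partial>M)"
      by (intro Bochner_Integration.integral_cong) (auto simp: max_def abs_if)
    also have "\<dots> = 2 * (\<integral>u. max 0 (f u - F n u) \<partial>M) - (integral\<^sup>L M f - integral\<^sup>L M (F n))"
      using int F f by simp
    finally show ?thesis using F(3) by simp
  qed
  ultimately show ?thesis by simp
qed

lemma tendsto_double_limit:
  fixes B :: "nat \<Rightarrow> real"
  assumes "\<And>k. (\<lambda>n. E k n) \<longlonglongrightarrow> V k" "V \<longlonglongrightarrow> v" "d \<longlonglongrightarrow> 0"
    and "\<And>k. eventually (\<lambda>n. \<bar>B n - E k n\<bar> \<le> d k) sequentially"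
  shows "B \<longlonglongrightarrow> v"
proof (rule tendstoI)
  fix e :: real assume "e > 0"
  have "eventually (\<lambda>k. dist (V k) v < e / 3 \<and> dist (d k) 0 < e / 3) sequentially"
    using tendstoD[OF assms(2), of "e/3"] tendstoD[OF assms(3), of "e/3"] \<open>e > 0\<close>
    by (intro eventually_conj) auto
  then obtain k where k: "dist (V k) v < e / 3" "dist (d k) 0 < e / 3"
    by (auto simp: eventually_sequentially)
  have "eventually (\<lambda>n. dist (E k n) (V k) < e / 3) sequentially"
    using tendstoD[OF assms(1)[of k], of "e/3"] \<open>e > 0\<close> by auto
  with assms(4)[of k] show "eventually (\<lambda>n. dist (B n) v < e) sequentially"
  proof eventually_elim
    case (elim n)
    then show ?case using k unfolding dist_real_def by linarith
  qed
qed

section \<open>From the log-concave \<open>b\<close> back to \<open>h\<close>, and the limit of the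
  cycle counts\<close>

context log_concave_coeffs begin

abbreviation "g \<equiv> gam_coeff \<gamma>"
abbreviation "h \<equiv> hseq g"
definition N :: "nat \<Rightarrow> real" where "N n = real n powr \<delta>"

lemma h_pos: "h n > 0"
  using hseq_pos[of g] gam_coeff_pos[OF \<gamma>] by blast

lemma perturb:
  assumes "\<And>j. j > M \<Longrightarrow> y j = x j"
  shows "(\<lambda>n. hseq y n / b n) \<longlonglongrightarrow> exp (\<Sum>j = 1..M. (y j - x j) / real j)"
  using b_pos b_inc b_ratio_lim assms by (rule hseq_perturb)

lemma h_b_lim: "\<exists>\<beta>>0. (\<lambda>n. h n / b n) \<longlonglongrightarrow> \<beta>"
proof (intro exI conjI)
  show "(\<lambda>n. h n / b n) \<longlonglongrightarrow> exp (\<Sum>j = 1..J. (g j - x j) / real j)"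
    by (rule perturb) (simp add: xJ)
qed simp

text \<open>Monotonicity was proved for \<open>b\<close>; the quotients \<open>h / b\<close> and
  \<open>b / h\<close> are bounded, which transfers it to \<open>h\<close> up to a constant.\<close>

lemma h_ratio_bound: "\<exists>K>0. \<forall>n i. h (n - i) / h n \<le> K"
proof -
  obtain \<beta> where \<beta>: "\<beta> > 0" "(\<lambda>n. h n / b n) \<longlonglongrightarrow> \<beta>" using h_b_lim by blast
  have inv: "(\<lambda>n. b n / h n) \<longlonglongrightarrow> inverse \<beta>"
    using tendsto_inverse[OF \<beta>(2)] \<beta>(1) by simp
  obtain K1 where K1: "K1 > 0" "\<And>n. \<bar>h n / b n\<bar> \<le> K1"
    using convergent_imp_Bseq[OF convergentI[OF \<beta>(2)]] unfolding Bseq_def by auto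
  obtain K2 where K2: "K2 > 0" "\<And>n. \<bar>b n / h n\<bar> \<le> K2"
    using convergent_imp_Bseq[OF convergentI[OF inv]] unfolding Bseq_def by auto
  have "h (n - i) / h n \<le> K1 * 1 * K2" for n i
  proof -
    have "h (n - i) / h n = h (n - i) / b (n - i) * (b (n - i) / b n) * (b n / h n)"
      using b_pos[of n] b_pos[of "n - i"] by simp
    also have "\<dots> \<le> K1 * 1 * K2"
      using K1(1) K1(2)[of "n - i"] K2(2)[of n] b_ratio_le_1[of n i] h_pos[of n] h_pos[of "n - i"] b_pos[of n] b_pos[of "n - i"]
      by (intro mult_mono) (auto simp: less_imp_le)
    finally show ?thesis .
  qed
  then show ?thesis using K1(1) K2(1) by (intro exI[of _ "K1 * 1 * K2"]) auto
qed

text \<open>Erasing the first \<open>m\<close> weights is a finite change and yields the factors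
  \<open>exp (- g j / j)\<close> by \<open>perturb\<close>; the shift by
  \<open>parts_size m k\<close> disappears because \<open>b (n - s) / b n\<close> tends to 1. The
  range \<open>M = max J m\<close> lets \<open>y\<close> and \<open>g\<close> be compared with the
  same \<open>x\<close>.\<close>

lemma parts_limit:
  "(\<lambda>n. parts_seq g m k n / h n) \<longlonglongrightarrow> (\<Prod>j\<in>{1..m}. exp (- (g j / real j)) * (g j / real j) ^ k j / fact (k j))"
proof -
  define y where "y j = (if j \<le> m then 0 else g j)" for j
  define M where "M = max J m"
  define s where "s = parts_size m k"
  have "(\<lambda>n. hseq y (n - s) / b (n - s)) \<longlonglongrightarrow> exp (\<Sum>j = 1..M. (y j - x j) / real j)"
    by (rule filterlim_compose[OF perturb filterlim_minus_const_nat_at_top]) (auto simp: y_def M_def xJ)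
  moreover have "(\<lambda>n. h n / b n) \<longlonglongrightarrow> exp (\<Sum>j = 1..M. (g j - x j) / real j)"
    by (rule perturb) (auto simp: M_def xJ)
  ultimately have "(\<lambda>n. hseq y (n - s) / b (n - s) * (b (n - s) / b n) / (h n / b n)) \<longlonglongrightarrow>
      exp (\<Sum>j = 1..M. (y j - x j) / real j) * 1 / exp (\<Sum>j = 1..M. (g j - x j) / real j)"
    by (intro tendsto_divide tendsto_mult b_ratio_lim) auto
  also have "(\<lambda>n. hseq y (n - s) / b (n - s) * (b (n - s) / b n) / (h n / b n)) = (\<lambda>n. hseq y (n - s) / h n)"
  proof
    fix n show "hseq y (n - s) / b (n - s) * (b (n - s) / b n) / (h n / b n) = hseq y (n - s) / h n"
      using b_pos[of n] b_pos[of "n - s"] by simp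
  qed
  also have "exp (\<Sum>j = 1..M. (y j - x j) / real j) * 1 / exp (\<Sum>j = 1..M. (g j - x j) / real j)
      = exp (\<Sum>j = 1..m. - (g j / real j))"
  proof -
    have "(\<Sum>j = 1..M. (y j - x j) / real j) - (\<Sum>j = 1..M. (g j - x j) / real j)
        = (\<Sum>j = 1..M. (y j - g j) / real j)"
      unfolding sum_subtractf[symmetric] by (intro sum.cong) (auto simp: diff_divide_distrib)
    also have "\<dots> = (\<Sum>j = 1..m. - (g j / real j))"
      by (rule sum.mono_neutral_cong_right) (auto simp: M_def y_def)
    finally show ?thesis by (simp add: exp_diff[symmetric] del: sum.cl_ivl_Suc)
  qed
  finally have lim: "(\<lambda>n. hseq y (n - s) / h n) \<longlonglongrightarrow> exp (\<Sum>j = 1..m. - (g j / real j))" .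
  have "(\<lambda>n. parts_coeff g m k * (hseq y (n - s) / h n)) \<longlonglongrightarrow> parts_coeff g m k * exp (\<Sum>j = 1..m. - (g j / real j))"
    by (intro tendsto_mult tendsto_const lim)
  moreover have "eventually (\<lambda>n. parts_coeff g m k * (hseq y (n - s) / h n) = parts_seq g m k n / h n) sequentially"
    using eventually_ge_at_top[of s]
    by eventually_elim (simp add: parts_seq_def s_def y_def[abs_def])
  moreover have "parts_coeff g m k * exp (\<Sum>j = 1..m. - (g j / real j)) =
     (\<Prod>j\<in>{1..m}. exp (- (g j / real j)) * (g j / real j) ^ k j / fact (k j))"
    unfolding parts_coeff_def exp_sum[OF finite_atLeastAtMost] prod.distrib[symmetric]
    by (intro prod.cong) auto
  ultimately show ?thesis by (simp add: Lim_transform_eventually)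
qed

lemma N_pos: "n \<ge> 1 \<Longrightarrow> N n > 0"
  by (simp add: N_def)

lemma N_at_top: "filterlim N at_top sequentially"
  unfolding N_def using \<gamma> by real_asymp

lemma N_powr: "n \<ge> 1 \<Longrightarrow> N n powr \<gamma> * N n = real n"
proof -
  assume n: "n \<ge> 1"
  have "N n powr \<gamma> * N n = N n powr (\<gamma> + 1)" using N_pos[OF n] by (simp add: powr_add)
  then show ?thesis using n \<gamma> by (simp add: N_def powr_powr)
qed

lemma len_prob_nonneg: "len_prob g n l \<ge> 0"
  using h_pos[of n] h_pos[of "n - l"] gam_coeff_pos[OF \<gamma>, of l]
  by (simp add: len_prob_def less_imp_le)

lemma sum_len_prob:
  assumes "n \<ge> 1"
  shows "(\<Sum>l = 1..n. len_prob g n l) = 1"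
proof -
  have "(\<Sum>l = 1..n. len_prob g n l) = (real n * h n) / (real n * h n)"
    unfolding len_prob_def sum_divide_distrib[symmetric] hseq_rec[of n g, symmetric] ..
  then show ?thesis using assms h_pos[of n] by simp
qed

text \<open>\<open>N n * len_prob g n (L n)\<close> splits into \<open>N n * g (L n) / n\<close>,
  which tends to \<open>u powr \<gamma>\<close>, a quotient of values of \<open>h / b\<close>, which
  tends to 1, and \<open>b (n - L n) / b n\<close>. The last is at least
  \<open>(1 - \<epsilon> n) ^ L n\<close> by \<open>b_minus_ge\<close>, where
  \<open>L n * \<epsilon> n\<close> tends to \<open>a * u\<close>.\<close>

lemma len_prob_lower:
  assumes u: "u > 0"
  defines "L \<equiv> \<lambda>n. nat \<lceil>u * N n\<rceil>"
  shows "eventually (\<lambda>n. L n \<le> n) sequentially" "(\<lambda>n. real (L n) / N n) \<longlonglongrightarrow> u"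
    "\<exists>G. G \<longlonglongrightarrow> u powr \<gamma> * exp (- a * u) \<and> eventually (\<lambda>n. G n \<le> N n * len_prob g n (L n)) sequentially"
proof -
  have L: "u * N n \<le> real (L n)" "real (L n) < u * N n + 1" for n
  proof -
    have "real (L n) = of_int \<lceil>u * N n\<rceil>"
      unfolding L_def using u by (simp add: N_def)
    then show "u * N n \<le> real (L n)" "real (L n) < u * N n + 1" by linarith+
  qed
  show LN: "(\<lambda>n. real (L n) / N n) \<longlonglongrightarrow> u"
  proof (rule tendsto_sandwich)
    show "eventually (\<lambda>n. u \<le> real (L n) / N n) sequentially"
      using eventually_ge_at_top[of 1]
      by eventually_elim (use L(1) N_pos in \<open>simp add: field_simps\<close>)
    show "eventually (\<lambda>n. real (L n) / N n \<le> u + inverse (N n)) sequentially"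
      using eventually_ge_at_top[of 1]
    proof eventually_elim
      case (elim n)
      then show ?case using less_imp_le[OF L(2)[of n]] N_pos[of n] by (simp add: field_simps)
    qed
    show "(\<lambda>n. u + inverse (N n)) \<longlonglongrightarrow> u"
      using tendsto_add[OF tendsto_const[of u] tendsto_inverse_0_at_top[OF N_at_top]] by simp
  qed simp
  have Nn: "(\<lambda>n. N n / real n) \<longlonglongrightarrow> 0"
    unfolding N_def using \<gamma> by real_asymp
  have Ln: "(\<lambda>n. real (L n) / real n) \<longlonglongrightarrow> 0"
  proof -
    have "(\<lambda>n. real (L n) / N n * (N n / real n)) \<longlonglongrightarrow> u * 0" by (intro tendsto_mult LN Nn)
    moreover have "eventually (\<lambda>n. real (L n) / N n * (N n / real n) = real (L n) / real n) sequentially"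
      using eventually_ge_at_top[of 1]
      by eventually_elim (use N_pos in \<open>force simp: less_imp_neq\<close>)
    ultimately show ?thesis by (simp add: Lim_transform_eventually)
  qed
  have "eventually (\<lambda>n. real (L n) / real n < 1) sequentially"
    using Ln by (rule order_tendstoD) simp
  then show Lle: "eventually (\<lambda>n. L n \<le> n) sequentially"
    using eventually_ge_at_top[of 1] by eventually_elim simp
  have L_top: "filterlim L at_top sequentially"
  proof -
    have "filterlim (\<lambda>n. u * N n) at_top sequentially"
      by (rule filterlim_tendsto_pos_mult_at_top[OF tendsto_const u N_at_top])
    then have "filterlim (\<lambda>n. real (L n)) at_top sequentially"
      by (rule filterlim_at_top_mono) (simp add: L(1))
    then show ?thesis using filterlim_sequentially_iff_filterlim_real by blast
  qed
  have nL: "filterlim (\<lambda>n. n - L n) at_top sequentially"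
  proof -
    have "filterlim (\<lambda>n. (1 - real (L n) / real n) * real n) at_top sequentially"
      by (rule filterlim_tendsto_pos_mult_at_top[OF tendsto_diff[OF tendsto_const Ln] _ filterlim_real_sequentially]) simp
    then have "filterlim (\<lambda>n. real (n - L n)) at_top sequentially"
    proof (rule filterlim_at_top_mono)
      show "eventually (\<lambda>n. (1 - real (L n) / real n) * real n \<le> real (n - L n)) sequentially"
        using eventually_ge_at_top[of 1] by eventually_elim (simp add: algebra_simps)
    qed
    then show ?thesis using filterlim_sequentially_iff_filterlim_real by blast
  qed
  define \<epsilon> where "\<epsilon> n = a * (real (n - L n) - C) powr (- \<delta>)" for n
  have nLC: "filterlim (\<lambda>n. real (n - L n) - C) at_top sequentially"
    using filterlim_tendsto_add_at_top[OF tendsto_const[of "- C"] filterlim_compose[OF filterlim_real_sequentially nL]]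
    by simp
  have \<epsilon>0: "\<epsilon> \<longlonglongrightarrow> 0"
    unfolding \<epsilon>_def using \<gamma> by (intro tendsto_mult_right_zero tendsto_neg_powr nLC) simp
  \<comment> \<open>Factoring n out of \<open>n - L n - C\<close> leaves a factor tending to 1, and
    \<open>n powr (- \<delta>)\<close> is \<open>1 / N n\<close>.\<close>
  have L\<epsilon>: "(\<lambda>n. real (L n) * \<epsilon> n) \<longlonglongrightarrow> a * u"
  proof -
    have "(\<lambda>n. 1 - real (L n) / real n - C * inverse (real n)) \<longlonglongrightarrow> 1 - 0 - C * 0"
      by (intro tendsto_intros Ln lim_inverse_n)
    then have "(\<lambda>n. (1 - real (L n) / real n - C * inverse (real n)) powr (- \<delta>)) \<longlonglongrightarrow> 1 powr (- \<delta>)"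
      by (intro tendsto_powr tendsto_const) auto
    then have "(\<lambda>n. a * (real (L n) / N n) * (1 - real (L n) / real n - C * inverse (real n)) powr (- \<delta>)) \<longlonglongrightarrow> a * u * 1 powr (- \<delta>)"
      by (intro tendsto_mult LN tendsto_const)
    moreover have "eventually (\<lambda>n. a * (real (L n) / N n) * (1 - real (L n) / real n - C * inverse (real n)) powr (- \<delta>)
        = real (L n) * \<epsilon> n) sequentially"
      using eventually_ge_at_top[of 1] Lle nLC[unfolded filterlim_at_top_dense, rule_format, of 0]
    proof eventually_elim
      case (elim n)
      have "real (n - L n) - C = real n * (1 - real (L n) / real n - C * inverse (real n))"
        using elim by (simp add: field_simps of_nat_diff)
      moreover from this have "1 - real (L n) / real n - C * inverse (real n) > 0"
        using elim by (simp add: zero_less_mult_iff)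
      ultimately have "(real (n - L n) - C) powr (- \<delta>) = inverse (N n) * (1 - real (L n) / real n - C * inverse (real n)) powr (- \<delta>)"
        by (simp add: powr_mult N_def powr_minus)
      then show ?case by (simp add: \<epsilon>_def divide_inverse)
    qed
    ultimately show ?thesis by (simp add: Lim_transform_eventually)
  qed
  have gL: "(\<lambda>n. N n * g (L n) / real n) \<longlonglongrightarrow> u powr \<gamma>"
  proof -
    have "(\<lambda>n. g (L n) / real (L n) powr \<gamma> * (real (L n) / N n) powr \<gamma>) \<longlonglongrightarrow> 1 * u powr \<gamma>"
      using u by (intro tendsto_mult filterlim_compose[OF gam_coeff_asymp[OF \<gamma>] L_top] tendsto_powr LN tendsto_const) auto
    moreover have "eventually (\<lambda>n. g (L n) / real (L n) powr \<gamma> * (real (L n) / N n) powr \<gamma> = N n * g (L n) / real n) sequentially"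
      using eventually_ge_at_top[of 1] L_top[unfolded filterlim_at_top, rule_format, of 1]
    proof eventually_elim
      case (elim n)
      then show ?case
        using N_powr[of n, symmetric] N_pos[of n] by (simp add: powr_divide)
    qed
    ultimately show ?thesis by (simp add: Lim_transform_eventually)
  qed
  obtain \<beta> where \<beta>: "\<beta> > 0" "(\<lambda>n. h n / b n) \<longlonglongrightarrow> \<beta>" using h_b_lim by blast
  define G where "G n = N n * g (L n) / real n * ((h (n - L n) / b (n - L n)) / (h n / b n)
     * exp (- (real (L n) * \<epsilon> n / (1 - \<epsilon> n))))" for n
  have "G \<longlonglongrightarrow> u powr \<gamma> * (\<beta> / \<beta> * exp (- (a * u / (1 - 0))))"
    unfolding G_def using \<beta>
    by (intro tendsto_intros gL filterlim_compose[OF \<beta>(2) nL] L\<epsilon> \<epsilon>0) auto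
  then have "G \<longlonglongrightarrow> u powr \<gamma> * exp (- a * u)" using \<beta> by simp
  moreover have "eventually (\<lambda>n. G n \<le> N n * len_prob g n (L n)) sequentially"
    using eventually_ge_at_top[of 1] Lle nLC[unfolded filterlim_at_top_dense, rule_format, of 0]
      order_tendstoD(2)[OF \<epsilon>0 zero_less_one]
  proof eventually_elim
    case (elim n)
    have \<epsilon>_pos: "\<epsilon> n > 0" using elim a_pos by (simp add: \<epsilon>_def)
    \<comment> \<open>The inequality 1 + t <= exp t at
      \<open>t = \<epsilon> n / (1 - \<epsilon> n)\<close> bounds \<open>1 - \<epsilon> n\<close>
      from below by exp (-t); this is the origin of the exponential in \<open>G\<close>.\<close>
    have "1 + \<epsilon> n / (1 - \<epsilon> n) \<le> exp (\<epsilon> n / (1 - \<epsilon> n))" by (rule exp_ge_add_one_self)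
    moreover have "1 + \<epsilon> n / (1 - \<epsilon> n) = inverse (1 - \<epsilon> n)" using elim by (simp add: field_simps)
    ultimately have "inverse (exp (\<epsilon> n / (1 - \<epsilon> n))) \<le> 1 - \<epsilon> n"
      using elim le_imp_inverse_le[of "inverse (1 - \<epsilon> n)" "exp (\<epsilon> n / (1 - \<epsilon> n))"] by simp
    then have "exp (- (\<epsilon> n / (1 - \<epsilon> n))) ^ L n \<le> (1 - \<epsilon> n) ^ L n"
      unfolding exp_minus by (intro power_mono) auto
    also have "\<dots> \<le> b (n - L n) / b n"
      unfolding \<epsilon>_def using elim by (intro b_minus_ge) (auto simp: \<epsilon>_def)
    finally have *: "exp (- (real (L n) * \<epsilon> n / (1 - \<epsilon> n))) \<le> b (n - L n) / b n"
      by (simp add: exp_of_nat_mult[symmetric])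
    have "G n \<le> N n * g (L n) / real n * ((h (n - L n) / b (n - L n)) / (h n / b n) * (b (n - L n) / b n))"
      unfolding G_def using N_pos[of n] gam_coeff_pos[OF \<gamma>, of "L n"] elim b_pos h_pos
      by (intro mult_left_mono *) (auto simp: less_imp_le)
    also have "\<dots> = N n * len_prob g n (L n)"
      using b_pos[of n] b_pos[of "n - L n"] by (simp add: len_prob_def)
    finally show ?case .
  qed
  ultimately show "\<exists>G. G \<longlonglongrightarrow> u powr \<gamma> * exp (- a * u) \<and> eventually (\<lambda>n. G n \<le> N n * len_prob g n (L n)) sequentially"
    by blast
qed

section \<open>Weak convergence\<close>

definition f :: "real \<Rightarrow> real" where
  "f u = indicator {0..} u * (u powr \<gamma> * exp (- a * u))"

text \<open>The constant \<open>a\<close> inherited from \<open>b_ratio_bound\<close> is exactly the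
  normalising one; the Scheffe argument rests on this.\<close>

lemma f_bochner: "has_bochner_integral lborel f 1"
proof -
  have "a powr (\<gamma> + 1) = Gamma (\<gamma> + 1)"
    using \<gamma> by (simp add: a_def powr_powr Gamma_real_pos less_imp_le)
  moreover have "Gamma (\<gamma> + 1) \<noteq> 0"
    using \<gamma> by (intro less_imp_neq[THEN not_sym] Gamma_real_pos) simp
  ultimately show ?thesis
    using gamma_density_integral[of "\<gamma> + 1" a] \<gamma> a_pos by (simp add: f_def[abs_def])
qed

lemma f_nonneg: "f u \<ge> 0"
  by (simp add: f_def)

lemma f_measurable [measurable]: "f \<in> borel_measurable borel"
  using f_bochner by (auto simp: has_bochner_integral_iff dest: borel_measurable_integrable)

text \<open>Spreads the mass \<open>c l\<close> uniformly over the interval of length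
  \<open>1 / N n\<close> ending at \<open>l / N n\<close>, so the total integral is the sum of
  \<open>c\<close>.\<close>

definition step :: "nat \<Rightarrow> (nat \<Rightarrow> real) \<Rightarrow> real \<Rightarrow> real" where
  "step n c u = (\<Sum>l = 1..n. (N n * c l) * indicator {(real l - 1) / N n<..real l / N n} u)"

lemma step_bochner:
  assumes "n \<ge> 1"
  shows "has_bochner_integral lborel (step n c) (\<Sum>l = 1..n. c l)"
  using step_function_integral[OF N_pos[OF assms], where c = "\<lambda>l. N n * c l" and n = n] N_pos[OF assms]
  by (simp add: step_def[abs_def])

text \<open>The index is \<open>Suc n\<close> because for n = 0 there is no probability distribution
  and \<open>N 0 = 0\<close>.\<close>

lemma step_len_prob_L1:
  "(\<lambda>n. \<integral>u. \<bar>step (Suc n) (len_prob g (Suc n)) u - f u\<bar> \<partial>lborel) \<longlonglongrightarrow> 0"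
proof (rule scheffe_lower)
  fix n
  show "integrable lborel (step (Suc n) (len_prob g (Suc n)))"
    using step_bochner[of "Suc n"] by (simp add: has_bochner_integral_iff)
  show "step (Suc n) (len_prob g (Suc n)) u \<ge> 0" for u
    unfolding step_def using N_pos[of "Suc n"] len_prob_nonneg
    by (intro sum_nonneg mult_nonneg_nonneg) (auto intro: less_imp_le)
  show "integral\<^sup>L lborel (step (Suc n) (len_prob g (Suc n))) = integral\<^sup>L lborel f"
    using step_bochner[of "Suc n" "len_prob g (Suc n)"] sum_len_prob[of "Suc n"] f_bochner
    by (simp add: has_bochner_integral_iff)
  show "integrable lborel f" "f u \<ge> 0" for u
    using f_bochner by (simp_all add: has_bochner_integral_iff f_nonneg)
  show "AE u in lborel. (\<lambda>n. max 0 (f u - step (Suc n) (len_prob g (Suc n)) u)) \<longlonglongrightarrow> 0"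
  proof (rule AE_I2)
    fix u :: real
    show "(\<lambda>n. max 0 (f u - step (Suc n) (len_prob g (Suc n)) u)) \<longlonglongrightarrow> 0"
    proof (cases "u > 0")
      case False
      then have "f u = 0" by (simp add: f_def indicator_def)
      moreover have "step (Suc n) (len_prob g (Suc n)) u = 0" for n
        using False N_pos[of "Suc n"] unfolding step_def by (intro step_function_nonpos) auto
      ultimately show ?thesis by simp
    next
      case True
      then have fu: "f u = u powr \<gamma> * exp (- a * u)" by (simp add: f_def)
      obtain G where G: "G \<longlonglongrightarrow> f u"
        "eventually (\<lambda>n. G n \<le> N n * len_prob g n (nat \<lceil>u * N n\<rceil>)) sequentially"
        using len_prob_lower(3)[OF True] unfolding fu by blast
      have "(\<lambda>n. max 0 (f u - step n (len_prob g n) u)) \<longlonglongrightarrow> 0"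
      proof (rule tendsto_sandwich[of "\<lambda>_. 0" _ _ "\<lambda>n. max 0 (f u - G n)"])
        show "(\<lambda>n. max 0 (f u - G n)) \<longlonglongrightarrow> 0"
          using tendsto_max[OF tendsto_const[of 0] tendsto_diff[OF tendsto_const[of "f u"] G(1)]] by simp
        show "eventually (\<lambda>n. max 0 (f u - step n (len_prob g n) u) \<le> max 0 (f u - G n)) sequentially"
          using G(2) len_prob_lower(1)[OF True] eventually_ge_at_top[of 1]
        proof eventually_elim
          case (elim n)
          then have "step n (len_prob g n) u = N n * len_prob g n (nat \<lceil>u * N n\<rceil>)"
            unfolding step_def using N_pos[of n] True by (subst step_function_eq) auto
          then show ?case using elim by auto
        qed
      qed auto
      then show ?thesis by (rule LIMSEQ_Suc)
    qed
  qed
qed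

text \<open>The sum is the integral of the step density against \<open>r n\<close>, which rounds the
  argument of \<open>\<phi>\<close> up to the grid. Replacing the density by \<open>f\<close> costs
  at most \<open>B\<close> times the L1 distance; then \<open>r n\<close> tends to
  \<open>\<phi>\<close> at continuity points, with majorant \<open>B * f\<close>.\<close>

lemma weak_convergence:
  fixes \<phi> :: "real \<Rightarrow> real"
  assumes [measurable]: "\<phi> \<in> borel_measurable borel" and B: "\<And>u. \<bar>\<phi> u\<bar> \<le> B"
    and cont: "AE u in lborel. isCont \<phi> u"
  shows "(\<lambda>n. \<Sum>l = 1..n. \<phi> (real l / N n) * len_prob g n l) \<longlonglongrightarrow> (\<integral>u. \<phi> u * f u \<partial>lborel)"
proof -
  define r where "r n u = \<phi> (of_int \<lceil>u * N n\<rceil> / N n)" for n u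
  have [measurable]: "r n \<in> borel_measurable borel" for n
    unfolding r_def[abs_def] by measurable
  have rB: "\<bar>r n u\<bar> \<le> B" for n u unfolding r_def by (rule B)
  let ?F = "\<lambda>n. step n (len_prob g n)"
  have intf: "integrable lborel f" using f_bochner by (simp add: has_bochner_integral_iff)
  have intF: "integrable lborel (?F (Suc n))" for n
    using step_bochner[of "Suc n" "len_prob g (Suc n)"] by (simp add: has_bochner_integral_iff)
  have [measurable]: "?F (Suc n) \<in> borel_measurable borel" for n
    using borel_measurable_integrable[OF intF] by simp
  have B0: "B \<ge> 0" using B[of 0] by linarith
  have int_rf: "integrable lborel (\<lambda>u. r n u * f u)" for n
    by (rule Bochner_Integration.integrable_bound[OF integrable_mult_right[OF intf, of B]])
      (auto simp: abs_mult f_nonneg B0 intro!: mult_right_mono rB)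
  have int_rF: "integrable lborel (\<lambda>u. r (Suc n) u * ?F (Suc n) u)" for n
    by (rule Bochner_Integration.integrable_bound[OF integrable_mult_right[OF integrable_abs[OF intF[of n]], of B]])
      (auto simp: abs_mult B0 intro!: mult_right_mono rB)
  have "(\<lambda>n. \<integral>u. r n u * f u \<partial>lborel) \<longlonglongrightarrow> (\<integral>u. \<phi> u * f u \<partial>lborel)"
  proof (rule integral_dominated_convergence[where w = "\<lambda>u. B * f u"])
    show "AE u in lborel. (\<lambda>n. r n u * f u) \<longlonglongrightarrow> \<phi> u * f u"
      using cont
    proof eventually_elim
      case (elim u)
      have "(\<lambda>n. of_int \<lceil>u * N n\<rceil> / N n) \<longlonglongrightarrow> u"
      proof (rule tendsto_sandwich)
        show "eventually (\<lambda>n. u \<le> of_int \<lceil>u * N n\<rceil> / N n) sequentially"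
          using eventually_ge_at_top[of 1]
          by eventually_elim (use N_pos in \<open>simp add: field_simps\<close>)
        show "eventually (\<lambda>n. of_int \<lceil>u * N n\<rceil> / N n \<le> u + inverse (N n)) sequentially"
          using eventually_ge_at_top[of 1]
        proof eventually_elim
          case (elim n)
          have "of_int \<lceil>u * N n\<rceil> \<le> u * N n + 1" by linarith
          then show ?case using N_pos[of n] elim by (simp add: field_simps)
        qed
        show "(\<lambda>n. u + inverse (N n)) \<longlonglongrightarrow> u"
          using tendsto_add[OF tendsto_const[of u] tendsto_inverse_0_at_top[OF N_at_top]] by simp
      qed simp
      from isCont_tendsto_compose[OF elim this]
      show ?case unfolding r_def by (intro tendsto_mult tendsto_const)
    qed
    show "AE u in lborel. norm (r n u * f u) \<le> B * f u" for n
      using rB f_nonneg by (auto simp: abs_mult intro!: mult_right_mono)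
  qed (use intf in auto)
  then have lim1: "(\<lambda>n. \<integral>u. r (Suc n) u * f u \<partial>lborel) \<longlonglongrightarrow> (\<integral>u. \<phi> u * f u \<partial>lborel)"
    by (rule LIMSEQ_Suc)
  have lim2: "(\<lambda>n. (\<integral>u. r (Suc n) u * ?F (Suc n) u \<partial>lborel) - (\<integral>u. r (Suc n) u * f u \<partial>lborel)) \<longlonglongrightarrow> 0"
  proof (rule Lim_null_comparison)
    show "(\<lambda>n. B * (\<integral>u. \<bar>?F (Suc n) u - f u\<bar> \<partial>lborel)) \<longlonglongrightarrow> 0"
      using tendsto_mult_right_zero[OF step_len_prob_L1] .
    show "eventually (\<lambda>n. norm ((\<integral>u. r (Suc n) u * ?F (Suc n) u \<partial>lborel) - (\<integral>u. r (Suc n) u * f u \<partial>lborel))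
       \<le> B * (\<integral>u. \<bar>?F (Suc n) u - f u\<bar> \<partial>lborel)) sequentially"
    proof (intro always_eventually allI)
      fix n
      have "(\<integral>u. r (Suc n) u * ?F (Suc n) u \<partial>lborel) - (\<integral>u. r (Suc n) u * f u \<partial>lborel)
         = (\<integral>u. r (Suc n) u * (?F (Suc n) u - f u) \<partial>lborel)"
        using int_rF[of n] int_rf[of "Suc n"] by (simp add: right_diff_distrib)
      also have "norm \<dots> \<le> (\<integral>u. B * \<bar>?F (Suc n) u - f u\<bar> \<partial>lborel)"
      proof (rule Bochner_Integration.integral_norm_bound_integral)
        show "integrable lborel (\<lambda>u. r (Suc n) u * (?F (Suc n) u - f u))"
          using Bochner_Integration.integrable_diff[OF int_rF[of n] int_rf[of "Suc n"]] by (simp add: right_diff_distrib)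
        show "integrable lborel (\<lambda>u. B * \<bar>?F (Suc n) u - f u\<bar>)"
          using intF intf by (intro integrable_mult_right integrable_abs Bochner_Integration.integrable_diff)
      qed (auto simp: abs_mult intro!: mult_right_mono rB)
      finally show "norm ((\<integral>u. r (Suc n) u * ?F (Suc n) u \<partial>lborel) - (\<integral>u. r (Suc n) u * f u \<partial>lborel))
       \<le> B * (\<integral>u. \<bar>?F (Suc n) u - f u\<bar> \<partial>lborel)" by simp
    qed
  qed
  have "(\<integral>u. r n u * ?F n u \<partial>lborel) = (\<Sum>l = 1..n. \<phi> (real l / N n) * len_prob g n l)" if n: "n \<ge> 1" for n
  proof -
    have "r n u * ?F n u = step n (\<lambda>l. \<phi> (real l / N n) * len_prob g n l) u" for u
    proof (cases "u > 0")
      case True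
      then have "real (nat \<lceil>u * N n\<rceil>) = of_int \<lceil>u * N n\<rceil>" using N_pos[OF n] by simp
      then show ?thesis
        unfolding step_def step_function_eq[OF N_pos[OF n] True] by (simp add: r_def)
    next
      case False
      then show ?thesis
        unfolding step_def using N_pos[OF n] by (subst (1 2) step_function_nonpos) auto
    qed
    then show ?thesis
      using step_bochner[OF n, of "\<lambda>l. \<phi> (real l / N n) * len_prob g n l"]
      by (simp add: has_bochner_integral_iff)
  qed
  then have "(\<lambda>n. \<Sum>l = 1..Suc n. \<phi> (real l / N (Suc n)) * len_prob g (Suc n) l) =
     (\<lambda>n. ((\<integral>u. r (Suc n) u * ?F (Suc n) u \<partial>lborel) - (\<integral>u. r (Suc n) u * f u \<partial>lborel)) + (\<integral>u. r (Suc n) u * f u \<partial>lborel))"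
    by (intro ext) simp
  also have "\<dots> \<longlonglongrightarrow> (\<integral>u. \<phi> u * f u \<partial>lborel)"
    using tendsto_add[OF lim2 lim1] by simp
  finally show ?thesis by (rule LIMSEQ_imp_Suc)
qed

lemma cyc_len_limit:
  assumes "s > 0"
  shows "(\<lambda>n. \<Sum>l = 1..n. of_bool (real l / N n < s) * len_prob g n l)
           \<longlonglongrightarrow> integral {0..s} (\<lambda>u. u powr \<gamma> * exp (- a * u))"
proof -
  define \<phi> where "\<phi> = (indicator {..<s} :: real \<Rightarrow> real)"
  have "(\<lambda>n. \<Sum>l = 1..n. \<phi> (real l / N n) * len_prob g n l) \<longlonglongrightarrow> (\<integral>u. \<phi> u * f u \<partial>lborel)"
  proof (rule weak_convergence)
    have "AE u in lborel. u \<noteq> s" by (rule AE_lborel_singleton)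
    then show "AE u in lborel. isCont \<phi> u"
    proof eventually_elim
      case (elim u)
      then have "u \<notin> frontier {..<s}" by (simp add: frontier_def interior_open)
      then show ?case unfolding \<phi>_def by (simp add: isCont_indicator)
    qed
    show "\<bar>\<phi> u\<bar> \<le> 1" for u by (simp add: \<phi>_def indicator_def)
  qed (simp add: \<phi>_def)
  moreover have "(\<integral>u. \<phi> u * f u \<partial>lborel) = integral {0..s} (\<lambda>u. u powr \<gamma> * exp (- a * u))"
  proof -
    have "integrable lborel (\<lambda>u. \<phi> u * f u)"
      using integrable_mult_indicator[of "{..<s}" lborel f] f_bochner
      by (simp add: has_bochner_integral_iff \<phi>_def)
    then have "((\<lambda>u. \<phi> u * f u) has_integral (\<integral>u. \<phi> u * f u \<partial>lborel)) UNIV"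
      by (rule has_integral_integral_lborel)
    then have "((\<lambda>u. if u \<in> {0..s} then u powr \<gamma> * exp (- a * u) else 0) has_integral (\<integral>u. \<phi> u * f u \<partial>lborel)) UNIV"
      \<comment> \<open>The indicators of \<open>{..<s}\<close> and \<open>{0..s}\<close> give
        integrands that differ at most at the point \<open>s\<close>.\<close>
      by (rule has_integral_spike[of "{s}", rotated 2]) (auto simp: \<phi>_def f_def indicator_def)
    then have "((\<lambda>u. u powr \<gamma> * exp (- a * u)) has_integral (\<integral>u. \<phi> u * f u \<partial>lborel)) {0..s}"
      by (simp only: has_integral_restrict_UNIV)
    then show ?thesis by (rule integral_unique[symmetric])
  qed
  moreover have "\<phi> t = of_bool (t < s)" for t by (simp add: \<phi>_def indicator_def)
  ultimately show ?thesis by simp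
qed

section \<open>The mean number of cycles\<close>

lemma sum_gam_coeff_div:
  "(\<Sum>l = 1..M. g l / real l) \<le> (1 + \<gamma>) / \<gamma> * g M"
proof -
  \<comment> \<open>Telescoping: \<open>g l - g (l - 1) = \<gamma> * g (l - 1) / l\<close>, while
    \<open>g l <= (1 + \<gamma>) * g (l - 1)\<close>.\<close>
  have "(\<Sum>l = 1..M. g l / real l) \<le> (1 + \<gamma>) / \<gamma> * (g M - g 0)"
  proof (induction M)
    case (Suc M)
    let ?c = "(1 + \<gamma>) / \<gamma>"
    have "1 + \<gamma> / real (Suc M) \<le> 1 + \<gamma>" using \<gamma> by (simp add: field_simps)
    then have "g M * (1 + \<gamma> / real (Suc M)) / real (Suc M) \<le> g M * (1 + \<gamma>) / real (Suc M)"
      using gam_coeff_pos[OF \<gamma>, of M] by (intro divide_right_mono mult_left_mono) auto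
    also have "\<dots> = ?c * (g (Suc M) - g M)"
      unfolding gam_coeff_Suc[OF \<gamma>] using \<gamma> by (simp add: divide_simps del: of_nat_Suc) (simp add: algebra_simps)
    finally have "g (Suc M) / real (Suc M) \<le> ?c * (g (Suc M) - g M)"
      unfolding gam_coeff_Suc[OF \<gamma>] .
    then show ?case using Suc by (simp add: algebra_simps del: of_nat_Suc)
  qed simp
  also have "\<dots> \<le> (1 + \<gamma>) / \<gamma> * g M"
    using \<gamma> gam_coeff_pos[OF \<gamma>, of 0] by (intro mult_left_mono) auto
  finally show ?thesis .
qed

text \<open>The test function 1/u is unbounded at 0, so weak convergence says nothing about the
  contribution of lengths below \<open>e * N n\<close>. Bounded quotients of \<open>h\<close> and
  the order of the partial sums of \<open>g l / l\<close> make it small with e, uniformly in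
  n.\<close>

lemma short_cycles_bound:
  "\<exists>D>0. \<forall>n\<ge>1. \<forall>e>0. (\<Sum>l\<in>{l\<in>{1..n}. real l \<le> e * N n}. N n / real l * len_prob g n l) \<le> D * e powr \<gamma>"
proof -
  obtain K where K: "K > 0" "\<And>n i. h (n - i) / h n \<le> K" using h_ratio_bound by blast
  obtain A where A: "A > 0" "\<And>n. \<bar>g n / real n powr \<gamma>\<bar> \<le> A"
    using convergent_imp_Bseq[OF convergentI[OF gam_coeff_asymp[OF \<gamma>]]] unfolding Bseq_def by auto
  define D where "D = K * ((1 + \<gamma>) / \<gamma> * A)"
  have "(\<Sum>l\<in>{l\<in>{1..n}. real l \<le> e * N n}. N n / real l * len_prob g n l) \<le> D * e powr \<gamma>"
    if n: "n \<ge> 1" and e: "e > 0" for n e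
  proof -
    define M where "M = nat \<lfloor>e * N n\<rfloor>"
    note Np = N_pos[OF n]
    have M_le: "real M \<le> e * N n" using Np e by (simp add: M_def)
    have sub: "{l\<in>{1..n}. real l \<le> e * N n} \<subseteq> {1..M}"
      using Np e by (auto simp: M_def le_nat_floor)
    have "(\<Sum>l\<in>{l\<in>{1..n}. real l \<le> e * N n}. N n / real l * len_prob g n l)
       \<le> (\<Sum>l = 1..M. N n / real l * len_prob g n l)"
      using sub Np len_prob_nonneg by (intro sum_mono2) auto
    also have "\<dots> \<le> (\<Sum>l = 1..M. K * N n / real n * (g l / real l))"
    proof (rule sum_mono)
      fix l
      have "N n / real l * len_prob g n l = N n / real n * (g l / real l) * (h (n - l) / h n)"
        by (simp add: len_prob_def mult_ac)
      also have "\<dots> \<le> N n / real n * (g l / real l) * K"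
        using Np gam_coeff_pos[OF \<gamma>, of l] by (intro mult_left_mono K(2)) auto
      finally show "N n / real l * len_prob g n l \<le> K * N n / real n * (g l / real l)"
        by (simp add: mult_ac)
    qed
    also have "\<dots> = K * N n / real n * (\<Sum>l = 1..M. g l / real l)"
      by (simp add: sum_distrib_left)
    also have "\<dots> \<le> K * N n / real n * ((1 + \<gamma>) / \<gamma> * (A * (e * N n) powr \<gamma>))"
    proof (intro mult_left_mono)
      show "(\<Sum>l = 1..M. g l / real l) \<le> (1 + \<gamma>) / \<gamma> * (A * (e * N n) powr \<gamma>)"
      proof (cases "M = 0")
        case True
        then show ?thesis using A \<gamma> by simp
      next
        case False
        have "g M \<le> A * real M powr \<gamma>"
          using A(2)[of M] False by (simp add: field_simps abs_le_iff)
        also have "\<dots> \<le> A * (e * N n) powr \<gamma>"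
          using A(1) M_le \<gamma> by (intro mult_left_mono powr_mono2) auto
        finally have "(1 + \<gamma>) / \<gamma> * g M \<le> (1 + \<gamma>) / \<gamma> * (A * (e * N n) powr \<gamma>)"
          using \<gamma> by (intro mult_left_mono) auto
        then show ?thesis using sum_gam_coeff_div[of M] by linarith
      qed
    qed (use K(1) Np in auto)
    also have "\<dots> = D * e powr \<gamma> * ((N n powr \<gamma> * N n) / real n)"
      using Np e by (simp add: D_def powr_mult mult_ac)
    also have "\<dots> = D * e powr \<gamma>" using N_powr[OF n] n by simp
    finally show ?thesis .
  qed
  moreover have "D > 0" using K(1) A(1) \<gamma> by (simp add: D_def)
  ultimately show ?thesis by blast
qed

text \<open>\<open>N n / l\<close> is 1/u at \<open>u = l / N n\<close>. Truncation to
  \<open>1 / max u (e k)\<close> gives a bounded continuous test function; the error stems only from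
  lengths up to \<open>e k * N n\<close>, and the truncated integrals converge to the mean of 1/u
  under the limit density.\<close>

lemma num_cycles_limit:
  "(\<lambda>n. \<Sum>l = 1..n. N n / real l * len_prob g n l) \<longlonglongrightarrow> Gamma \<gamma> / a powr \<gamma>"
proof -
  obtain D where D: "\<And>n e. n \<ge> 1 \<Longrightarrow> e > 0 \<Longrightarrow>
      (\<Sum>l\<in>{l\<in>{1..n}. real l \<le> e * N n}. N n / real l * len_prob g n l) \<le> D * e powr \<gamma>"
    using short_cycles_bound by blast
  define e where "e k = inverse (real (Suc k))" for k
  have e_pos: "e k > 0" for k by (simp add: e_def)
  have e0: "e \<longlonglongrightarrow> 0" unfolding e_def by (rule LIMSEQ_inverse_real_of_nat)
  define \<phi> where "\<phi> k u = 1 / max u (e k)" for k and u :: real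
  have \<phi>_nonneg: "\<phi> k u \<ge> 0" for k u using e_pos[of k] by (simp add: \<phi>_def le_max_iff_disj less_imp_le)
  let ?F = "\<lambda>u. indicator {0..} u * (u powr (\<gamma> - 1) * exp (- a * u))"
  show ?thesis
  proof (rule tendsto_double_limit)
    show "(\<lambda>n. \<Sum>l = 1..n. \<phi> k (real l / N n) * len_prob g n l) \<longlonglongrightarrow> (\<integral>u. \<phi> k u * f u \<partial>lborel)" for k
    proof (rule weak_convergence)
      show "\<bar>\<phi> k u\<bar> \<le> 1 / e k" for u
        using e_pos[of k] \<phi>_nonneg[of k u] by (simp add: \<phi>_def frac_le)
      have "isCont (\<phi> k) u" for u
        unfolding \<phi>_def[abs_def] using e_pos[of k] by (intro continuous_intros) (auto simp: max_def)
      then show "AE u in lborel. isCont (\<phi> k) u" by simp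
      show "\<phi> k \<in> borel_measurable borel" unfolding \<phi>_def[abs_def] by measurable
    qed
    have F: "has_bochner_integral lborel ?F (Gamma \<gamma> / a powr \<gamma>)"
      using \<gamma> a_pos by (rule gamma_density_integral)
    have "(\<lambda>k. \<integral>u. \<phi> k u * f u \<partial>lborel) \<longlonglongrightarrow> (\<integral>u. ?F u \<partial>lborel)"
    proof (rule integral_dominated_convergence[where w = ?F])
      show "integrable lborel ?F" using F by (simp add: has_bochner_integral_iff)
      have F_eq: "?F u = 1 / u * f u" for u
        by (cases "u > 0") (auto simp: f_def indicator_def powr_diff)
      show "AE u in lborel. (\<lambda>k. \<phi> k u * f u) \<longlonglongrightarrow> ?F u"
      proof (rule AE_I2)
        fix u :: real
        show "(\<lambda>k. \<phi> k u * f u) \<longlonglongrightarrow> ?F u"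
        proof (cases "u > 0")
          case True
          have "(\<lambda>k. max u (e k)) \<longlonglongrightarrow> max u 0" by (intro tendsto_max tendsto_const e0)
          then have "(\<lambda>k. \<phi> k u * f u) \<longlonglongrightarrow> 1 / max u 0 * f u"
            unfolding \<phi>_def using True by (intro tendsto_mult tendsto_divide tendsto_const) auto
          then show ?thesis unfolding F_eq using True by simp
        next
          case False
          then have "f u = 0" using \<gamma> by (auto simp: f_def indicator_def)
          then show ?thesis unfolding F_eq by simp
        qed
      qed
      show "AE u in lborel. norm (\<phi> k u * f u) \<le> ?F u" for k
      proof (rule AE_I2)
        fix u :: real
        show "norm (\<phi> k u * f u) \<le> ?F u"
        proof (cases "u > 0")
          case True
          then have "\<phi> k u \<le> 1 / u" unfolding \<phi>_def by (intro divide_left_mono) auto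
          then show ?thesis unfolding F_eq using f_nonneg[of u] \<phi>_nonneg[of k u]
            by (simp only: real_norm_def abs_mult abs_of_nonneg mult_right_mono)
        next
          case False
          then have "f u = 0" using \<gamma> by (auto simp: f_def indicator_def)
          then show ?thesis unfolding F_eq by simp
        qed
      qed
    qed (auto simp: \<phi>_def[abs_def])
    then show "(\<lambda>k. \<integral>u. \<phi> k u * f u \<partial>lborel) \<longlonglongrightarrow> Gamma \<gamma> / a powr \<gamma>"
      using F by (simp add: has_bochner_integral_iff)
    show "(\<lambda>k. D * e k powr \<gamma>) \<longlonglongrightarrow> 0"
    proof -
      have "(\<lambda>k. e k powr \<gamma>) \<longlonglongrightarrow> 0 powr \<gamma>"
        using e0 \<gamma> by (intro tendsto_powr2 tendsto_const) (simp_all add: e_pos less_imp_le)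
      then show ?thesis by (intro tendsto_mult_right_zero) simp
    qed
    fix k
    show "eventually (\<lambda>n. \<bar>(\<Sum>l = 1..n. N n / real l * len_prob g n l) - (\<Sum>l = 1..n. \<phi> k (real l / N n) * len_prob g n l)\<bar>
        \<le> D * e k powr \<gamma>) sequentially"
      using eventually_ge_at_top[of 1]
    proof eventually_elim
      case (elim n)
      note Np = N_pos[OF elim]
      \<comment> \<open>The truncation error: zero beyond \<open>e k * N n\<close>, elsewhere
        between 0 and the untruncated term.\<close>
      let ?t = "\<lambda>l. (N n / real l - \<phi> k (real l / N n)) * len_prob g n l"
      have t: "0 \<le> ?t l" "?t l \<le> N n / real l * len_prob g n l" "real l > e k * N n \<Longrightarrow> ?t l = 0"
        if "l \<ge> 1" for l
      proof -
        have "\<phi> k (real l / N n) \<le> 1 / (real l / N n)"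
          unfolding \<phi>_def using that Np by (intro frac_le) auto
        then show "0 \<le> ?t l" using len_prob_nonneg[of n l] by (intro mult_nonneg_nonneg) auto
        show "?t l \<le> N n / real l * len_prob g n l"
          using len_prob_nonneg[of n l] \<phi>_nonneg by (intro mult_right_mono) auto
        assume "real l > e k * N n"
        then have "max (real l / N n) (e k) = real l / N n" using Np by (simp add: field_simps max_def)
        then show "?t l = 0" by (simp add: \<phi>_def)
      qed
      have "(\<Sum>l = 1..n. N n / real l * len_prob g n l) - (\<Sum>l = 1..n. \<phi> k (real l / N n) * len_prob g n l) = (\<Sum>l = 1..n. ?t l)"
        by (simp add: sum_subtractf left_diff_distrib)
      moreover have "(\<Sum>l = 1..n. ?t l) \<ge> 0" using t(1) by (intro sum_nonneg) auto
      moreover have "(\<Sum>l = 1..n. ?t l) \<le> D * e k powr \<gamma>"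
      proof -
        have "(\<Sum>l = 1..n. ?t l) = (\<Sum>l\<in>{l\<in>{1..n}. real l \<le> e k * N n}. ?t l)"
        proof (rule sum.mono_neutral_right)
          show "\<forall>l\<in>{1..n} - {l\<in>{1..n}. real l \<le> e k * N n}. ?t l = 0"
          proof
            fix l assume "l \<in> {1..n} - {l\<in>{1..n}. real l \<le> e k * N n}"
            then have "l \<ge> 1" "real l > e k * N n" by auto
            then show "?t l = 0" by (rule t(3))
          qed
        qed auto
        also have "\<dots> \<le> (\<Sum>l\<in>{l\<in>{1..n}. real l \<le> e k * N n}. N n / real l * len_prob g n l)"
          using t(2) by (intro sum_mono) auto
        also have "\<dots> \<le> D * e k powr \<gamma>" by (rule D[OF elim e_pos])
        finally show ?thesis .
      qed
      ultimately show ?case by simp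
    qed
  qed
qed

end

theorem theorem5p1:
  fixes \<gamma> :: real and \<theta> :: "nat \<Rightarrow> real" and a :: real
  assumes "\<gamma> > 0"
    and "\<And>n. n \<ge> 1 \<Longrightarrow> \<theta> n = Gamma (real n + \<gamma> + 1) / fact n"
    and "a = Gamma (\<gamma> + 1) powr (1 / (\<gamma> + 1))"
  shows
    "(\<forall>s>0. (\<lambda>n. Pn \<theta> n {\<sigma>. real (cyc_len1 \<sigma>) / real n powr (1 / (1 + \<gamma>)) < s})
        \<longlonglongrightarrow> integral {0..s} (\<lambda>x. x powr \<gamma> * exp (- a * x)))
   \<and> (\<lambda>n. real n powr (- \<gamma> / (\<gamma> + 1)) * En \<theta> n (\<lambda>\<sigma>. real (num_cycles n \<sigma>)))
        \<longlonglongrightarrow> (Gamma \<gamma> / \<gamma> powr \<gamma>) powr (1 / (\<gamma> + 1))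
   \<and> (\<forall>m (k :: nat \<Rightarrow> nat).
        (\<lambda>n. Pn \<theta> n {\<sigma>. \<forall>j\<in>{1..m}. cyc_count n \<sigma> j = k j})
        \<longlonglongrightarrow> (\<Prod>j\<in>{1..m}. exp (- (\<theta> j / j)) * (\<theta> j / j) ^ k j / fact (k j)))"
proof (intro conjI allI impI)
  obtain x J where "x 0 = 1" "\<And>j. x j > 0" "incseq x" "decseq (\<lambda>j. x (Suc j) / x j)"
    "\<And>j. j \<ge> J \<Longrightarrow> x j = gam_coeff \<gamma> j"
    using log_concave_modification[OF assms(1)] by blast
  then interpret L: log_concave_coeffs \<gamma> x J
    using assms(1) by unfold_locales auto
  let ?g = "gam_coeff \<gamma>"
  \<comment> \<open>\<open>\<theta> 0\<close> is arbitrary, so the transfer to \<open>?g\<close>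
    goes through \<open>hseq_cong\<close>, which compares sequences from index 1 on.\<close>
  have \<theta>: "\<theta> j = ?g j" if "j \<ge> 1" for j using assms(2)[OF that] by (simp add: gam_coeff_def)
  have a: "L.a = a" by (simp add: L.a_def assms(3))
  have N: "L.N n = real n powr (1 / (1 + \<gamma>))" for n by (simp add: L.N_def add.commute)
  have h: "hseq \<theta> = hseq ?g" by (rule hseq_cong) (rule \<theta>)
  have lp: "len_prob \<theta> n l = len_prob ?g n l" if "l \<ge> 1" for n l
    using \<theta>[OF that] by (simp add: len_prob_def h)
  {
    fix s :: real assume s: "s > 0"
    have "eventually (\<lambda>n. (\<Sum>l = 1..n. of_bool (real l / L.N n < s) * len_prob ?g n l)
       = Pn \<theta> n {\<sigma>. real (cyc_len1 \<sigma>) / real n powr (1 / (1 + \<gamma>)) < s}) sequentially"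
      using eventually_ge_at_top[of 1]
    proof eventually_elim
      case (elim n)
      show ?case
        using prob_cyc_len1[OF elim, of \<theta> "\<lambda>l. real l / real n powr (1 / (1 + \<gamma>)) < s"]
        by (simp add: N lp)
    qed
    with L.cyc_len_limit[OF s] show "(\<lambda>n. Pn \<theta> n {\<sigma>. real (cyc_len1 \<sigma>) / real n powr (1 / (1 + \<gamma>)) < s})
        \<longlonglongrightarrow> integral {0..s} (\<lambda>x. x powr \<gamma> * exp (- a * x))"
      unfolding a by (rule Lim_transform_eventually)
  }
  have "eventually (\<lambda>n. (\<Sum>l = 1..n. L.N n / real l * len_prob ?g n l)
     = real n powr (- \<gamma> / (\<gamma> + 1)) * En \<theta> n (\<lambda>\<sigma>. real (num_cycles n \<sigma>))) sequentially"
    using eventually_ge_at_top[of 1]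
  proof eventually_elim
    case (elim n)
    \<comment> \<open>The factor n from \<open>expectation_num_cycles\<close> turns the
      normalisation into \<open>L.N n\<close>.\<close>
    have "- \<gamma> / (\<gamma> + 1) + 1 = 1 / (\<gamma> + 1)" using assms(1) by (simp add: field_simps)
    then have "L.N n = real n powr (- \<gamma> / (\<gamma> + 1)) * real n powr 1"
      by (simp only: L.N_def powr_add[symmetric])
    then show ?case
      using elim by (simp add: expectation_num_cycles sum_distrib_left lp mult_ac)
  qed
  \<comment> \<open>By the functional equation \<open>L.a powr \<gamma>\<close> is the power
    \<open>\<gamma> / (\<gamma> + 1)\<close> of \<open>\<gamma> * Gamma \<gamma>\<close>, which
    leaves \<open>Gamma \<gamma>\<close> with exponent \<open>1 / (\<gamma> + 1)\<close>.\<close>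
  moreover have "Gamma \<gamma> / L.a powr \<gamma> = (Gamma \<gamma> / \<gamma> powr \<gamma>) powr (1 / (\<gamma> + 1))"
  proof -
    have G: "Gamma \<gamma> > 0" using assms(1) by (simp add: Gamma_real_pos)
    have "\<gamma> \<notin> \<int>\<^sub>\<le>\<^sub>0" using assms(1) by (auto elim!: nonpos_Ints_cases)
    then have "Gamma (\<gamma> + 1) = \<gamma> * Gamma \<gamma>" by (rule Gamma_plus1)
    then have "Gamma \<gamma> / L.a powr \<gamma> = Gamma \<gamma> / (\<gamma> powr (\<gamma> / (\<gamma> + 1)) * Gamma \<gamma> powr (\<gamma> / (\<gamma> + 1)))"
      using assms(1) G by (simp add: L.a_def powr_mult powr_powr)
    also have "\<dots> = Gamma \<gamma> powr (1 - \<gamma> / (\<gamma> + 1)) / \<gamma> powr (\<gamma> / (\<gamma> + 1))"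
      using G by (simp add: powr_diff)
    also have "1 - \<gamma> / (\<gamma> + 1) = 1 / (\<gamma> + 1)" using assms(1) by (simp add: field_simps)
    finally show ?thesis using assms(1) G by (simp add: powr_divide powr_powr)
  qed
  ultimately show "(\<lambda>n. real n powr (- \<gamma> / (\<gamma> + 1)) * En \<theta> n (\<lambda>\<sigma>. real (num_cycles n \<sigma>)))
        \<longlonglongrightarrow> (Gamma \<gamma> / \<gamma> powr \<gamma>) powr (1 / (\<gamma> + 1))"
    using L.num_cycles_limit by (auto intro: Lim_transform_eventually)
  fix m and k :: "nat \<Rightarrow> nat"
  have "parts_seq \<theta> m k n = parts_seq ?g m k n" for n
  proof -
    have "hseq (\<lambda>j. if j \<le> m then 0 else \<theta> j) = hseq (\<lambda>j. if j \<le> m then 0 else ?g j)"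
      by (rule hseq_cong) (simp add: \<theta>)
    moreover have "parts_coeff \<theta> m k = parts_coeff ?g m k"
      unfolding parts_coeff_def by (intro prod.cong) (auto simp: \<theta>)
    ultimately show ?thesis by (simp add: parts_seq_def)
  qed
  moreover have "(\<Prod>j\<in>{1..m}. exp (- (\<theta> j / j)) * (\<theta> j / j) ^ k j / fact (k j)) =
     (\<Prod>j\<in>{1..m}. exp (- (?g j / j)) * (?g j / j) ^ k j / fact (k j))"
    by (intro prod.cong) (auto simp: \<theta>)
  ultimately show "(\<lambda>n. Pn \<theta> n {\<sigma>. \<forall>j\<in>{1..m}. cyc_count n \<sigma> j = k j})
        \<longlonglongrightarrow> (\<Prod>j\<in>{1..m}. exp (- (\<theta> j / j)) * (\<theta> j / j) ^ k j / fact (k j))"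
    using L.parts_limit[of m k] unfolding prob_cyc_counts h by simp
qed

end
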